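(* Let $u_n^\circ(x)=\kappa_n^\circ((-\infty,x])$ for $x\in\mathbb R$, where $\kappa_n^\circ$ are the initial empirical measures, and assume that the sequence $\kappa_n^\circ$ is bounded in total variation and tight. Then the following are equivalent: 1. $u_n^\circ$ converges uniformly to $u^\circ$, and $u^\circ$ is continuous; 2. $u_n^\circ$ converges locally uniformly to $u^\circ$, and $u^\circ$ is continuous; 3. (a) $\kappa_n^\circ$ converges narrowly to $\kappa^\circ$, (b) $\kappa^\circ$ has no atoms, and (c) there exist a sequence $s_n\to0$ (as $n\to\infty$) and a modulus of continuity $\omega$ such that $$|\kappa_n^\circ((x,y])|\le s_n+\omega(|x-y|)\qquad\text{for all }-\infty<x\le y<\infty .$$ The limits $u^\circ$ and $\kappa^\circ$ are connected by $u^\circ(x)=\kappa^\circ((-\infty,x])$.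
   Context: For each $n\ge2$ consider $n$ particles on the real line with initial positions $x_1^\circ,\dots,x_n^\circ\in\mathbb R$ and initial charges $b_1^\circ,\dots,b_n^\circ$, each $+1$ or $-1$ (a charge $0$ denotes a neutral particle, which is effectively removed); positions and charges depend on $n$. The initial empirical measure is the signed measure $\kappa_n^\circ:=\frac1n\sum_{i=1}^nb_i^\circ\delta_{x_i^\circ}$, so that $u_n^\circ(x)=\kappa_n^\circ((-\infty,x])=\frac1n\sum_{i=1}^nb_i^\circ H(x-x_i^\circ)$, where $H$ is the Heaviside function with $H(0)=1$. Here $u^\circ$ is a real function on $\mathbb R$ and $\kappa^\circ$ is a finite signed measure on $\mathbb R$. Bounded in total variation means $\sup_n|\kappa_n^\circ|(\mathbb R)<\infty$. The sequence is tight if for every $\varepsilon>0$ there is $R>0$ with $|\kappa_n^\circ|(\mathbb R\setminus[-R,R])<\varepsilon$ for all $n$. Narrow convergence means $\int\varphi\,d\kappa_n^\circ\to\int\varphi\,d\kappa^\circ$ for every bounded continuous $\varphi:\mathbb R\to\mathbb R$. A measure has no atoms if every singleton has measure zero. A modulus of continuity is a nondecreasing function $\omega:[0,\infty)\to[0,\infty)$ with $\omega(0)=0$ and $\omega(r)\to0$ as $r\to0$. *)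

theory Defs
  imports "HOL-Analysis.Analysis"
begin

text \<open>Finite signed measures on the line are countably additive real-valued functions of Borel
  sets; their values on other sets are irrelevant.\<close>

definition signed_measure :: "(real set \<Rightarrow> real) \<Rightarrow> bool" where
  "signed_measure \<kappa> \<longleftrightarrow>
     \<kappa> {} = 0 \<and>
     (\<forall>A :: nat \<Rightarrow> real set. range A \<subseteq> sets borel \<longrightarrow> disjoint_family A \<longrightarrow>
        (\<lambda>i. \<kappa> (A i)) sums \<kappa> (\<Union>i. A i))"

definition total_variation :: "(real set \<Rightarrow> real) \<Rightarrow> real set \<Rightarrow> ennreal" where
  "total_variation \<kappa> A =
     (SUP P \<in> {P. finite P \<and> P \<subseteq> sets borel \<and> disjoint P \<and> \<Union>P = A}. \<Sum>B\<in>P. ennreal \<bar>\<kappa> B\<bar>)"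

text \<open>The positive part of the Jordan decomposition, as the upper variation of \<open>\<kappa>\<close>; the negative
  part is the positive part of \<open>-\<kappa>\<close>. Note that \<^const>\<open>ennreal\<close> sends negative reals to \<open>0\<close>,
  which is harmless as \<open>B = {}\<close> is admitted.\<close>

definition pos_part :: "(real set \<Rightarrow> real) \<Rightarrow> real measure" where
  "pos_part \<kappa> =
     measure_of UNIV (sets borel) (\<lambda>A. SUP B \<in> {B \<in> sets borel. B \<subseteq> A}. ennreal (\<kappa> B))"

definition neg_part :: "(real set \<Rightarrow> real) \<Rightarrow> real measure" where
  "neg_part \<kappa> = pos_part (\<lambda>A. - \<kappa> A)"

definition signed_integral :: "(real set \<Rightarrow> real) \<Rightarrow> (real \<Rightarrow> real) \<Rightarrow> real" where
  "signed_integral \<kappa> \<phi> = integral\<^sup>L (pos_part \<kappa>) \<phi> - integral\<^sup>L (neg_part \<kappa>) \<phi>"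

definition narrowly_converges ::
    "(nat \<Rightarrow> real set \<Rightarrow> real) \<Rightarrow> (real set \<Rightarrow> real) \<Rightarrow> bool" where
  "narrowly_converges \<kappa>s \<kappa> \<longleftrightarrow>
     (\<forall>\<phi>. continuous_on UNIV \<phi> \<longrightarrow> bounded (range \<phi>) \<longrightarrow>
        (\<lambda>n. signed_integral (\<kappa>s n) \<phi>) \<longlonglongrightarrow> signed_integral \<kappa> \<phi>)"

definition no_atoms :: "(real set \<Rightarrow> real) \<Rightarrow> bool" where
  "no_atoms \<kappa> \<longleftrightarrow> (\<forall>x. \<kappa> {x} = 0)"

text \<open>Sequences are indexed by \<open>n \<ge> 2\<close>, the number of particles.\<close>

definition bounded_variation_seq :: "(nat \<Rightarrow> real set \<Rightarrow> real) \<Rightarrow> bool" where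
  "bounded_variation_seq \<kappa>s \<longleftrightarrow> (SUP n \<in> {2..}. total_variation (\<kappa>s n) UNIV) < \<infinity>"

definition tight_seq :: "(nat \<Rightarrow> real set \<Rightarrow> real) \<Rightarrow> bool" where
  "tight_seq \<kappa>s \<longleftrightarrow>
     (\<forall>\<epsilon>::real. \<epsilon> > 0 \<longrightarrow>
        (\<exists>R>0. \<forall>n\<ge>2. total_variation (\<kappa>s n) (UNIV - {-R..R}) < ennreal \<epsilon>))"

text \<open>Only the values on \<open>[0, \<infinity>)\<close> matter.\<close>

definition modulus_of_continuity :: "(real \<Rightarrow> real) \<Rightarrow> bool" where
  "modulus_of_continuity \<omega> \<longleftrightarrow>
     (\<forall>r\<ge>0. \<omega> r \<ge> 0) \<and> mono_on {0..} \<omega> \<and> \<omega> 0 = 0 \<and> (\<omega> \<longlongrightarrow> 0) (at_right 0)"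

definition locally_uniform_limit :: "(nat \<Rightarrow> real \<Rightarrow> real) \<Rightarrow> (real \<Rightarrow> real) \<Rightarrow> bool" where
  "locally_uniform_limit f l \<longleftrightarrow> (\<forall>K. compact K \<longrightarrow> uniform_limit K f l sequentially)"

text \<open>The \<open>n\<close>-particle configuration consists of the positions \<open>x n i\<close> and charges \<open>b n i\<close>,
  \<open>i = 1, \<dots>, n\<close>; the Dirac measure at \<open>a\<close> is \<open>A \<mapsto> indicator A a\<close>.\<close>

definition empirical_measure ::
    "(nat \<Rightarrow> nat \<Rightarrow> real) \<Rightarrow> (nat \<Rightarrow> nat \<Rightarrow> real) \<Rightarrow> nat \<Rightarrow> real set \<Rightarrow> real" where
  "empirical_measure x b n A = (1 / real n) * (\<Sum>i=1..n. b n i * indicator A (x n i))"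

end

theory Submission
  imports Defs "HOL-Probability.Helly_Selection"
begin

text \<open>Tightness controls \<open>u\<^sub>n\<close> and its limit uniformly outside a compact interval, so local uniform
  convergence is uniform. Given a continuous limit \<open>u\<close>, Helly selection applied to the Jordan parts of
  \<open>\<kappa>\<^sub>n\<close> writes \<open>u\<close> as a difference of two distribution functions and hence produces \<open>\<kappa>\<close>; narrow
  convergence of the whole sequence follows from pointwise convergence of \<open>u\<^sub>n\<close> by replacing a test
  function by a step function on a large interval, and \<open>\<omega>\<close> is the modulus of \<open>u\<close>. Conversely, the
  integral of a ramp that is 1 up to \<open>y\<close> and 0 beyond \<open>y + \<delta>\<close> is the average of \<open>\<kappa> {..z}\<close> over
  \<open>z \<in> {y..y + \<delta>}\<close>, which is within \<open>s\<^sub>n + \<omega> \<delta>\<close> of \<open>u\<^sub>n y\<close>. This gives pointwise convergence,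
  which the estimate on intervals upgrades to local uniform convergence with a continuous limit.\<close>

subsection \<open>Jordan parts of finite signed measures\<close>

lemma signed_measure_empty: "signed_measure \<kappa> \<Longrightarrow> \<kappa> {} = 0"
  by (simp add: signed_measure_def)

lemma signed_measure_sums:
  fixes A :: "nat \<Rightarrow> real set"
  assumes "signed_measure \<kappa>" "\<And>i. A i \<in> sets borel" "disjoint_family A"
  shows "(\<lambda>i. \<kappa> (A i)) sums \<kappa> (\<Union>i. A i)"
  using assms unfolding signed_measure_def by blast

lemma signed_measure_Un:
  assumes \<kappa>: "signed_measure \<kappa>" and "A \<in> sets borel" "B \<in> sets borel" "A \<inter> B = {}"
  shows "\<kappa> (A \<union> B) = \<kappa> A + \<kappa> B"
proof -
  have "(\<lambda>i. \<kappa> (binaryset A B i)) sums \<kappa> (\<Union>i. binaryset A B i)"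
    by (rule signed_measure_sums[OF \<kappa>]) (use assms in \<open>auto simp: binaryset_def disjoint_family_on_def\<close>)
  moreover have "(\<lambda>i. \<kappa> (binaryset A B i)) sums (\<Sum>i<2. \<kappa> (binaryset A B i))"
    by (rule sums_finite) (auto simp: binaryset_def signed_measure_empty[OF \<kappa>])
  ultimately show ?thesis
    by (simp add: UN_binaryset_eq sums_unique2 numeral_2_eq_2 binaryset_def)
qed

lemma signed_measure_Diff:
  assumes "signed_measure \<kappa>" "A \<in> sets borel" "B \<in> sets borel" "B \<subseteq> A"
  shows "\<kappa> (A - B) = \<kappa> A - \<kappa> B"
  using signed_measure_Un[of \<kappa> B "A - B"] assms by (auto simp: Un_absorb1)

lemma signed_measure_uminus:
  assumes "signed_measure \<kappa>" shows "signed_measure (\<lambda>A. - \<kappa> A)"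
  using assms by (auto simp: signed_measure_def intro!: sums_minus)

lemma signed_measure_diff:
  fixes M N :: "real measure"
  assumes M: "finite_borel_measure M" and N: "finite_borel_measure N"
  shows "signed_measure (\<lambda>A. measure M A - measure N A)"
proof -
  interpret M: finite_borel_measure M by fact
  interpret N: finite_borel_measure N by fact
  show ?thesis
    unfolding signed_measure_def
    by (auto intro!: sums_diff M.finite_measure_UNION N.finite_measure_UNION
        simp: M.M_is_borel N.M_is_borel)
qed

text \<open>If \<open>\<kappa>\<close> were unbounded, halving repeatedly would split off infinitely many disjoint sets, each of
  \<open>\<kappa>\<close>-value at least 1 in modulus.\<close>

lemma signed_measure_bounded:
  assumes \<kappa>: "signed_measure \<kappa>"
  shows "\<exists>C. \<forall>A\<in>sets borel. \<bar>\<kappa> A\<bar> \<le> C"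
proof (rule ccontr)
  assume unb: "\<not> ?thesis"
  define bad where "bad A \<longleftrightarrow> A \<in> sets borel \<and> (\<forall>C. \<exists>B\<in>sets borel. B \<subseteq> A \<and> \<bar>\<kappa> B\<bar> > C)" for A
  have "bad UNIV"
    using unb by (auto simp: bad_def not_le)
  moreover have "\<exists>B. bad B \<and> B \<subseteq> A \<and> 1 \<le> \<bar>\<kappa> (A - B)\<bar>" if bad_A: "bad A" for A
  proof -
    have A: "A \<in> sets borel" using bad_A by (simp add: bad_def)
    \<comment> \<open>The margin \<open>\<bar>\<kappa> A\<bar> + 1\<close> forces both
      \<open>\<kappa> B\<close> and \<open>\<kappa> (A - B)\<close> above 1 in modulus, so either
      piece can be kept as the next bad set while the other is split off.\<close>
    obtain B where B: "B \<in> sets borel" "B \<subseteq> A" "\<bar>\<kappa> B\<bar> > \<bar>\<kappa> A\<bar> + 1"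
      using bad_A unfolding bad_def by meson
    have d: "\<kappa> (A - B) = \<kappa> A - \<kappa> B"
      using signed_measure_Diff[OF \<kappa> A B(1,2)] .
    have AB: "A - (A - B) = B" using B by auto
    have "bad B \<or> bad (A - B)"
    proof (rule ccontr)
      assume "\<not> ?thesis"
      then have "\<not> bad B" "\<not> bad (A - B)" by auto
      then obtain C D where C: "\<And>E. E \<in> sets borel \<Longrightarrow> E \<subseteq> B \<Longrightarrow> \<bar>\<kappa> E\<bar> \<le> C"
        and D: "\<And>E. E \<in> sets borel \<Longrightarrow> E \<subseteq> A - B \<Longrightarrow> \<bar>\<kappa> E\<bar> \<le> D"
        using A B(1) unfolding bad_def by (meson not_less sets.Diff)
      have "\<bar>\<kappa> E\<bar> \<le> C + D" if E: "E \<in> sets borel" "E \<subseteq> A" for E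
      proof -
        have "\<kappa> E = \<kappa> (E \<inter> B \<union> (E - B))" by (simp add: Int_Diff_Un)
        also have "\<dots> = \<kappa> (E \<inter> B) + \<kappa> (E - B)"
          by (rule signed_measure_Un[OF \<kappa>]) (use E B in auto)
        finally show ?thesis
          using C[of "E \<inter> B"] D[of "E - B"] E B(1) by fastforce
      qed
      then show False
        using bad_A unfolding bad_def by (meson not_less)
    qed
    then show ?thesis
    proof
      assume "bad B"
      then show ?thesis using B d by (intro exI[of _ B]) auto
    next
      assume "bad (A - B)"
      then show ?thesis using B AB by (intro exI[of _ "A - B"]) auto
    qed
  qed
  ultimately obtain A where A: "\<And>n. bad (A n)" "\<And>n. A (Suc n) \<subseteq> A n"
      "\<And>n. 1 \<le> \<bar>\<kappa> (A n - A (Suc n))\<bar>"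
    using dependent_nat_choice[of "\<lambda>_. bad" "\<lambda>_ A B. B \<subseteq> A \<and> 1 \<le> \<bar>\<kappa> (A - B)\<bar>"] by metis
  have dec: "A n \<subseteq> A m" if "m \<le> n" for m n
    using that A(2) by (rule lift_Suc_antimono_le[rotated])
  have "disjoint_family (\<lambda>n. A n - A (Suc n))"
    unfolding disjoint_family_on_def
  proof (intro ballI impI)
    fix m n :: nat assume "m \<noteq> n"
    then show "(A m - A (Suc m)) \<inter> (A n - A (Suc n)) = {}"
      using dec[of "Suc m" n] dec[of "Suc n" m] by (cases m n rule: linorder_cases) auto
  qed
  then have "(\<lambda>n. \<kappa> (A n - A (Suc n))) sums \<kappa> (\<Union>n. A n - A (Suc n))"
    by (intro signed_measure_sums[OF \<kappa>]) (use A(1) in \<open>auto simp: bad_def\<close>)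
  then have "(\<lambda>n. \<kappa> (A n - A (Suc n))) \<longlonglongrightarrow> 0"
    by (auto dest: sums_summable summable_LIMSEQ_zero)
  then have "\<forall>\<^sub>F n in sequentially. \<bar>\<kappa> (A n - A (Suc n))\<bar> < 1"
    by (auto dest!: tendstoD[where e = 1] simp: dist_real_def)
  then show False
    using A(3) by (auto simp: eventually_sequentially not_less[symmetric])
qed

section \<open>Upper variation as a countably additive set function\<close>

text \<open>The set function given to \<open>measure_of\<close> in \<open>pos_part\<close>, isolated
  because \<open>measure_of\<close> returns it as \<open>emeasure\<close> only once it is known to
  be a measure.\<close>

definition upper_variation :: "(real set \<Rightarrow> real) \<Rightarrow> real set \<Rightarrow> ennreal" where
  "upper_variation \<kappa> A = (SUP B \<in> {B \<in> sets borel. B \<subseteq> A}. ennreal (\<kappa> B))"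

lemma upper_variation_upper:
  "B \<in> sets borel \<Longrightarrow> B \<subseteq> A \<Longrightarrow> ennreal (\<kappa> B) \<le> upper_variation \<kappa> A"
  by (auto simp: upper_variation_def intro: SUP_upper)

lemma upper_variation_least:
  "(\<And>B. B \<in> sets borel \<Longrightarrow> B \<subseteq> A \<Longrightarrow> ennreal (\<kappa> B) \<le> c) \<Longrightarrow> upper_variation \<kappa> A \<le> c"
  by (auto simp: upper_variation_def intro: SUP_least)

lemma upper_variation_mono: "A \<subseteq> B \<Longrightarrow> upper_variation \<kappa> A \<le> upper_variation \<kappa> B"
  by (auto intro!: upper_variation_least upper_variation_upper)

lemma upper_variation_empty: "signed_measure \<kappa> \<Longrightarrow> upper_variation \<kappa> {} = 0"
  by (simp add: upper_variation_def signed_measure_empty cong: conj_cong)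

text \<open>Disjoint competitors \<open>C \<subseteq> A\<close> and \<open>D \<subseteq> B\<close>
  unite to a competitor for \<open>A \<union> B\<close>; the two suprema are then pulled out one
  after the other.\<close>

lemma upper_variation_superadditive:
  assumes \<kappa>: "signed_measure \<kappa>" and AB: "A \<inter> B = {}"
  shows "upper_variation \<kappa> A + upper_variation \<kappa> B \<le> upper_variation \<kappa> (A \<union> B)"
proof -
  have *: "ennreal (\<kappa> C) + ennreal (\<kappa> D) \<le> upper_variation \<kappa> (A \<union> B)"
    if C: "C \<in> sets borel" "C \<subseteq> A" and D: "D \<in> sets borel" "D \<subseteq> B" for C D
  proof (cases "0 \<le> \<kappa> C \<and> 0 \<le> \<kappa> D")
    case True
    have "C \<inter> D = {}" using C D AB by auto
    with True have "ennreal (\<kappa> C) + ennreal (\<kappa> D) = ennreal (\<kappa> (C \<union> D))"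
      using signed_measure_Un[OF \<kappa> C(1) D(1)] by (simp flip: ennreal_plus)
    then show ?thesis
      using C D by (auto intro!: upper_variation_upper)
  next
    \<comment> \<open>A negative value is truncated to 0 by \<open>ennreal\<close>, so the sum is at
      most the value of the other set, which competes alone.\<close>
    case False
    then show ?thesis
      using upper_variation_upper[OF C(1) le_supI1[OF C(2)], of \<kappa> B]
        upper_variation_upper[OF D(1) le_supI2[OF D(2)], of \<kappa> A]
      by (auto simp: ennreal_neg not_le)
  qed
  have "upper_variation \<kappa> A + upper_variation \<kappa> B =
      (SUP C \<in> {C \<in> sets borel. C \<subseteq> A}. ennreal (\<kappa> C) + upper_variation \<kappa> B)"
    unfolding upper_variation_def[of \<kappa> A] by (rule ennreal_SUP_add_left[symmetric]) auto
  also have "\<dots> \<le> upper_variation \<kappa> (A \<union> B)"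
  proof (rule SUP_least)
    fix C assume C: "C \<in> {C \<in> sets borel. C \<subseteq> A}"
    have "ennreal (\<kappa> C) + upper_variation \<kappa> B =
        (SUP D \<in> {D \<in> sets borel. D \<subseteq> B}. ennreal (\<kappa> C) + ennreal (\<kappa> D))"
      unfolding upper_variation_def[of \<kappa> B] by (rule ennreal_SUP_add_right) auto
    also have "\<dots> \<le> upper_variation \<kappa> (A \<union> B)"
      using C by (intro SUP_least *) auto
    finally show "ennreal (\<kappa> C) + upper_variation \<kappa> B \<le> upper_variation \<kappa> (A \<union> B)" .
  qed
  finally show ?thesis .
qed

text \<open>Superadditivity bounds every finite partial sum by the variation of the union.
  Conversely, a competitor for the union is cut into its traces on the \<open>A i\<close>, each a
  competitor for \<open>A i\<close>.\<close>

lemma upper_variation_countably_additive: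
  assumes \<kappa>: "signed_measure \<kappa>"
  shows "countably_additive (sets borel) (upper_variation \<kappa>)"
proof (rule countably_additiveI)
  fix A :: "nat \<Rightarrow> real set"
  assume A: "range A \<subseteq> sets borel" "disjoint_family A"
  show "(\<Sum>i. upper_variation \<kappa> (A i)) = upper_variation \<kappa> (\<Union>i. A i)"
  proof (rule antisym)
    have "(\<Sum>i<n. upper_variation \<kappa> (A i)) \<le> upper_variation \<kappa> (\<Union>i<n. A i)" for n
    proof (induction n)
      case (Suc n)
      have "(\<Sum>i<Suc n. upper_variation \<kappa> (A i))
          \<le> upper_variation \<kappa> (\<Union>i<n. A i) + upper_variation \<kappa> (A n)"
        using Suc by (simp add: add_right_mono)
      also have "\<dots> \<le> upper_variation \<kappa> ((\<Union>i<n. A i) \<union> A n)"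
      proof (rule upper_variation_superadditive[OF \<kappa>])
        have "A i \<inter> A n = {}" if "i < n" for i
          by (rule disjoint_family_onD[OF A(2)]) (use that in auto)
        then show "(\<Union>i<n. A i) \<inter> A n = {}" by auto
      qed
      finally show ?case by (simp add: lessThan_Suc Un_commute)
    qed (simp add: upper_variation_empty[OF \<kappa>])
    then have "(\<Sum>i<n. upper_variation \<kappa> (A i)) \<le> upper_variation \<kappa> (\<Union>i. A i)" for n
      by (rule order_trans) (auto intro: upper_variation_mono)
    then show "(\<Sum>i. upper_variation \<kappa> (A i)) \<le> upper_variation \<kappa> (\<Union>i. A i)"
      by (intro suminf_le_const) auto
  next
    show "upper_variation \<kappa> (\<Union>i. A i) \<le> (\<Sum>i. upper_variation \<kappa> (A i))"
    proof (rule upper_variation_least)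
      fix B assume B: "B \<in> sets borel" "B \<subseteq> (\<Union>i. A i)"
      have "(\<lambda>i. \<kappa> (B \<inter> A i)) sums \<kappa> (\<Union>i. B \<inter> A i)"
        by (rule signed_measure_sums[OF \<kappa>])
          (use A B in \<open>auto simp: disjoint_family_on_def\<close>)
      also have "(\<Union>i. B \<inter> A i) = B" using B by auto
      finally have lim: "(\<lambda>n. ennreal (\<Sum>i<n. \<kappa> (B \<inter> A i))) \<longlonglongrightarrow> ennreal (\<kappa> B)"
        by (simp add: sums_def)
      have "ennreal (\<Sum>i<n. \<kappa> (B \<inter> A i)) \<le> (\<Sum>i. upper_variation \<kappa> (A i))" for n
      proof -
        \<comment> \<open>\<open>ennreal\<close> does not commute with sums that contain negative
          terms, hence the detour through positive parts.\<close>
        have "ennreal (\<Sum>i<n. \<kappa> (B \<inter> A i)) \<le> ennreal (\<Sum>i<n. max 0 (\<kappa> (B \<inter> A i)))"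
          by (intro ennreal_leI sum_mono) auto
        also have "\<dots> = (\<Sum>i<n. ennreal (\<kappa> (B \<inter> A i)))"
          by (subst sum_ennreal[symmetric]) (auto simp: ennreal_max_0)
        also have "\<dots> \<le> (\<Sum>i<n. upper_variation \<kappa> (A i))"
          using A B by (intro sum_mono upper_variation_upper) auto
        also have "\<dots> \<le> (\<Sum>i. upper_variation \<kappa> (A i))"
          by (rule sum_le_suminf) auto
        finally show ?thesis .
      qed
      then show "ennreal (\<kappa> B) \<le> (\<Sum>i. upper_variation \<kappa> (A i))"
        by (intro LIMSEQ_le_const2[OF lim]) auto
    qed
  qed
qed

section \<open>Jordan decomposition and comparison with total variation\<close>

lemma sets_pos_part [simp, measurable_cong]: "sets (pos_part \<kappa>) = sets borel"
  using sets.sigma_sets_eq[of "borel :: real measure"]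
  by (simp add: pos_part_def sets_measure_of_conv)

lemma sets_neg_part [simp, measurable_cong]: "sets (neg_part \<kappa>) = sets borel"
  by (simp add: neg_part_def)

lemma space_pos_part [simp]: "space (pos_part \<kappa>) = UNIV"
  by (simp add: pos_part_def space_measure_of_conv)

lemma emeasure_pos_part:
  assumes "signed_measure \<kappa>" "A \<in> sets borel"
  shows "emeasure (pos_part \<kappa>) A = upper_variation \<kappa> A"
proof (rule emeasure_measure_of[of _ UNIV "sets borel"])
  show "pos_part \<kappa> = measure_of UNIV (sets borel) (upper_variation \<kappa>)"
    by (simp add: pos_part_def upper_variation_def[abs_def])
qed (use assms in \<open>auto simp: positive_def upper_variation_empty upper_variation_countably_additive\<close>)

lemma finite_borel_measure_pos_part:
  assumes \<kappa>: "signed_measure \<kappa>"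
  shows "finite_borel_measure (pos_part \<kappa>)"
proof -
  obtain C where C: "\<And>A. A \<in> sets borel \<Longrightarrow> \<bar>\<kappa> A\<bar> \<le> C"
    using signed_measure_bounded[OF \<kappa>] by blast
  have "upper_variation \<kappa> UNIV \<le> ennreal C"
    by (intro upper_variation_least ennreal_leI) (use C in fastforce)
  then show ?thesis
    by (intro finite_borel_measure.intro finite_measureI finite_borel_measure_axioms.intro)
      (auto simp: emeasure_pos_part[OF \<kappa>] top_unique)
qed

lemma finite_borel_measure_neg_part:
  "signed_measure \<kappa> \<Longrightarrow> finite_borel_measure (neg_part \<kappa>)"
  unfolding neg_part_def by (intro finite_borel_measure_pos_part signed_measure_uminus)

text \<open>Complementation inside \<open>A\<close> turns \<open>- \<kappa> B\<close> into
  \<open>\<kappa> (A - B) - \<kappa> A\<close>, which is at most the positive part of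
  \<open>A\<close> minus \<open>\<kappa> A\<close>. The supremum over \<open>B\<close> gives one
  inequality, and the same inequality for \<open>-\<kappa>\<close> gives the other.\<close>

lemma signed_measure_eq_pos_minus_neg:
  assumes \<kappa>: "signed_measure \<kappa>" and A: "A \<in> sets borel"
  shows "\<kappa> A = measure (pos_part \<kappa>) A - measure (neg_part \<kappa>) A"
proof -
  have le: "\<kappa> A + measure (neg_part \<kappa>) A \<le> measure (pos_part \<kappa>) A"
    if \<kappa>: "signed_measure \<kappa>" for \<kappa>
  proof -
    interpret P: finite_borel_measure "pos_part \<kappa>" by (rule finite_borel_measure_pos_part[OF \<kappa>])
    interpret N: finite_borel_measure "neg_part \<kappa>" by (rule finite_borel_measure_neg_part[OF \<kappa>])
    have "emeasure (neg_part \<kappa>) A \<le> ennreal (measure (pos_part \<kappa>) A - \<kappa> A)"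
      unfolding neg_part_def emeasure_pos_part[OF signed_measure_uminus[OF \<kappa>] A]
    proof (intro upper_variation_least ennreal_leI)
      fix B assume B: "B \<in> sets borel" "B \<subseteq> A"
      have "ennreal (\<kappa> (A - B)) \<le> emeasure (pos_part \<kappa>) A"
        unfolding emeasure_pos_part[OF \<kappa> A] using A B by (intro upper_variation_upper) auto
      then have "\<kappa> (A - B) \<le> measure (pos_part \<kappa>) A"
        by (simp add: P.emeasure_eq_measure)
      then show "- \<kappa> B \<le> measure (pos_part \<kappa>) A - \<kappa> A"
        using signed_measure_Diff[OF \<kappa> A B] by simp
    qed
    \<comment> \<open>This makes the argument of \<open>ennreal\<close> above nonnegative, so the
      estimate can be read as one between real numbers.\<close>
    moreover have "\<kappa> A \<le> measure (pos_part \<kappa>) A"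
      using upper_variation_upper[of A A \<kappa>] A unfolding emeasure_pos_part[OF \<kappa> A, symmetric]
      by (simp add: P.emeasure_eq_measure)
    ultimately show ?thesis
      by (simp add: N.emeasure_eq_measure)
  qed
  have "neg_part (\<lambda>A. - \<kappa> A) = pos_part \<kappa>"
    by (simp add: neg_part_def)
  then show ?thesis
    using le[OF \<kappa>] le[OF signed_measure_uminus[OF \<kappa>]] by (simp add: neg_part_def)
qed

text \<open>The partition of \<open>A\<close> into \<open>B\<close> and \<open>A - B\<close> takes
  part in the supremum defining total variation. This carries boundedness and tightness over to the
  Jordan parts.\<close>

lemma pos_part_le_total_variation:
  assumes \<kappa>: "signed_measure \<kappa>" and A: "A \<in> sets borel"
  shows "emeasure (pos_part \<kappa>) A \<le> total_variation \<kappa> A"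
  unfolding emeasure_pos_part[OF assms]
proof (rule upper_variation_least)
  fix B assume B: "B \<in> sets borel" "B \<subseteq> A"
  have "ennreal (\<kappa> B) \<le> ennreal \<bar>\<kappa> B\<bar>"
    by (intro ennreal_leI) auto
  also have "\<dots> \<le> (\<Sum>C\<in>{B, A - B}. ennreal \<bar>\<kappa> C\<bar>)"
    by (rule member_le_sum) auto
  also have "\<dots> \<le> total_variation \<kappa> A"
    unfolding total_variation_def
    by (rule SUP_upper) (use A B in \<open>auto simp: disjoint_def\<close>)
  finally show "ennreal (\<kappa> B) \<le> total_variation \<kappa> A" .
qed

lemma total_variation_uminus: "total_variation (\<lambda>A. - \<kappa> A) = total_variation \<kappa>"
  by (simp add: total_variation_def[abs_def])

lemma neg_part_le_total_variation:
  assumes \<kappa>: "signed_measure \<kappa>" and A: "A \<in> sets borel"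
  shows "emeasure (neg_part \<kappa>) A \<le> total_variation \<kappa> A"
  using pos_part_le_total_variation[OF signed_measure_uminus[OF \<kappa>] A]
  by (simp add: neg_part_def total_variation_uminus)

subsection \<open>Step functions and ramps\<close>

text \<open>On each cell \<open>{T j<..T (Suc j)}\<close> the function is replaced by its value at
  the right endpoint, at a cost of \<epsilon>. Outside the grid the step function vanishes and the
  cost is at most \<open>B\<close>. Half-open cells make the integral of the step function a sum of
  increments of the distribution function.\<close>

lemma (in finite_borel_measure) step_approximation:
  fixes \<phi> :: "real \<Rightarrow> real" and T :: "nat \<Rightarrow> real"
  assumes \<phi>: "\<phi> \<in> borel_measurable borel" "\<And>t. \<bar>\<phi> t\<bar> \<le> B"
    and T: "\<And>j. T j \<le> T (Suc j)" and \<epsilon>: "0 \<le> \<epsilon>"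
    and osc: "\<And>j t. j < m \<Longrightarrow> t \<in> {T j<..T (Suc j)} \<Longrightarrow> \<bar>\<phi> t - \<phi> (T (Suc j))\<bar> \<le> \<epsilon>"
  shows "\<bar>(\<integral>t. \<phi> t \<partial>M) - (\<Sum>j<m. \<phi> (T (Suc j)) * (cdf M (T (Suc j)) - cdf M (T j)))\<bar>
    \<le> \<epsilon> * measure M UNIV + B * measure M (UNIV - {T 0<..T m})"
proof -
  note M_is_borel[measurable_cong] borel_UNIV[simp]
  have [measurable]: "\<phi> \<in> borel_measurable M" using \<phi>(1) by measurable
  define g where "g t = (\<Sum>j<m. \<phi> (T (Suc j)) * indicator {T j<..T (Suc j)} t)" for t
  have int_g: "integrable M g" and
    g: "(\<integral>t. g t \<partial>M) = (\<Sum>j<m. \<phi> (T (Suc j)) * (cdf M (T (Suc j)) - cdf M (T j)))"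
  proof -
    \<comment> \<open>The grid is only nondecreasing; on a degenerate cell both sides are 0.\<close>
    have *: "cdf M (T (Suc j)) - cdf M (T j) = measure M {T j<..T (Suc j)}" for j
      using T[of j] cdf_diff_eq by (cases "T j = T (Suc j)") auto
    show "integrable M g"
      unfolding g_def by (intro Bochner_Integration.integrable_sum integrable_mult_right integrable_real_indicator)
        (auto simp: less_top[symmetric])
    show "(\<integral>t. g t \<partial>M) = (\<Sum>j<m. \<phi> (T (Suc j)) * (cdf M (T (Suc j)) - cdf M (T j)))"
      unfolding g_def * by (subst Bochner_Integration.integral_sum) (auto simp: less_top[symmetric])
  qed
  have int_\<phi>: "integrable M \<phi>"
    by (rule integrable_const_bound[where B = B]) (use \<phi>(2) in auto)
  have mono: "T i \<le> T j" if "i \<le> j" for i j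
    using that T by (rule lift_Suc_mono_le[rotated])
  \<comment> \<open>Restricting to \<open>{T 0<..T k}\<close> makes the estimate inductive in
    \<open>k\<close>, one cell at a time. For \<open>t\<close> outside the grid it says that the
    step function is 0 there.\<close>
  have in_out: "\<bar>\<phi> t * indicator {T 0<..T k} t - (\<Sum>j<k. \<phi> (T (Suc j)) * indicator {T j<..T (Suc j)} t)\<bar>
      \<le> \<epsilon> * indicator {T 0<..T k} t" if "k \<le> m" for k t
    using that
  proof (induction k)
    case (Suc k)
    have "indicator {T 0<..T (Suc k)} t
        = indicator {T 0<..T k} t + (indicator {T k<..T (Suc k)} t :: real)"
      using mono[of 0 k] T[of k] by (auto simp: indicator_def)
    moreover have "\<bar>\<phi> t * indicator {T k<..T (Suc k)} t - \<phi> (T (Suc k)) * indicator {T k<..T (Suc k)} t\<bar>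
        \<le> \<epsilon> * indicator {T k<..T (Suc k)} t"
      using osc[of k t] Suc.prems by (auto simp: indicator_def)
    ultimately show ?case
      using Suc by (simp add: algebra_simps)
  qed simp
  have bound: "\<bar>\<phi> t - g t\<bar> \<le> \<epsilon> + B * indicator (UNIV - {T 0<..T m}) t" for t
  proof (cases "t \<in> {T 0<..T m}")
    case True
    then show ?thesis using in_out[of m t] by (simp add: g_def)
  next
    case False
    then show ?thesis using in_out[of m t] \<phi>(2)[of t] \<epsilon> by (simp add: g_def)
  qed
  have "\<bar>(\<integral>t. \<phi> t \<partial>M) - (\<integral>t. g t \<partial>M)\<bar> = \<bar>\<integral>t. \<phi> t - g t \<partial>M\<bar>"
    using int_\<phi> int_g by simp
  also have "\<dots> \<le> (\<integral>t. \<bar>\<phi> t - g t\<bar> \<partial>M)"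
    by (rule integral_abs_bound)
  also have "\<dots> \<le> (\<integral>t. \<epsilon> + B * indicator (UNIV - {T 0<..T m}) t \<partial>M)"
    using int_\<phi> int_g bound
    by (intro integral_mono integrable_abs Bochner_Integration.integrable_diff
        Bochner_Integration.integrable_add integrable_mult_right integrable_real_indicator)
      (auto simp: less_top[symmetric])
  also have "\<dots> = \<epsilon> * measure M UNIV + B * measure M (UNIV - {T 0<..T m})"
    by (subst Bochner_Integration.integral_add) (auto simp: less_top[symmetric])
  finally show ?thesis by (simp add: g)
qed

lemma signed_measure_atMost:
  "signed_measure \<kappa> \<Longrightarrow> \<kappa> {..y} = cdf (pos_part \<kappa>) y - cdf (neg_part \<kappa>) y"
  by (simp add: cdf_def signed_measure_eq_pos_minus_neg)

text \<open>Both Jordan parts use the same grid, so the two sums combine into one that involves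
  \<kappa> only through the values \<open>\<kappa> {..T j}\<close>. Pointwise convergence of
  distribution functions therefore passes through it.\<close>

lemma signed_step_approximation:
  fixes \<phi> :: "real \<Rightarrow> real" and T :: "nat \<Rightarrow> real"
  assumes \<kappa>: "signed_measure \<kappa>"
    and \<phi>: "\<phi> \<in> borel_measurable borel" "\<And>t. \<bar>\<phi> t\<bar> \<le> B"
    and T: "\<And>j. T j \<le> T (Suc j)" and \<epsilon>: "0 \<le> \<epsilon>"
    and osc: "\<And>j t. j < m \<Longrightarrow> t \<in> {T j<..T (Suc j)} \<Longrightarrow> \<bar>\<phi> t - \<phi> (T (Suc j))\<bar> \<le> \<epsilon>"
  shows "\<bar>signed_integral \<kappa> \<phi> - (\<Sum>j<m. \<phi> (T (Suc j)) * (\<kappa> {..T (Suc j)} - \<kappa> {..T j}))\<bar>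
    \<le> \<epsilon> * (measure (pos_part \<kappa>) UNIV + measure (neg_part \<kappa>) UNIV)
      + B * (measure (pos_part \<kappa>) (UNIV - {T 0<..T m}) + measure (neg_part \<kappa>) (UNIV - {T 0<..T m}))"
proof -
  let ?S = "\<lambda>M. \<Sum>j<m. \<phi> (T (Suc j)) * (cdf M (T (Suc j)) - cdf M (T j))"
  have "(\<Sum>j<m. \<phi> (T (Suc j)) * (\<kappa> {..T (Suc j)} - \<kappa> {..T j})) = ?S (pos_part \<kappa>) - ?S (neg_part \<kappa>)"
    unfolding sum_subtractf[symmetric] signed_measure_atMost[OF \<kappa>] by (simp add: algebra_simps)
  moreover note finite_borel_measure.step_approximation[OF finite_borel_measure_pos_part[OF \<kappa>], where \<phi> = \<phi> and T = T and m = m, OF \<phi> T \<epsilon> osc]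
    finite_borel_measure.step_approximation[OF finite_borel_measure_neg_part[OF \<kappa>], where \<phi> = \<phi> and T = T and m = m, OF \<phi> T \<epsilon> osc]
  ultimately show ?thesis
    unfolding signed_integral_def by (simp add: distrib_left)
qed

lemma continuous_uniform_grid:
  fixes \<phi> :: "real \<Rightarrow> real"
  assumes \<phi>: "continuous_on {a..b} \<phi>" and ab: "a < b" and \<epsilon>: "0 < \<epsilon>"
  obtains T :: "nat \<Rightarrow> real" and m where "\<And>j. T j \<le> T (Suc j)" "T 0 = a" "T m = b"
    "\<And>j t. j < m \<Longrightarrow> t \<in> {T j<..T (Suc j)} \<Longrightarrow> \<bar>\<phi> t - \<phi> (T (Suc j))\<bar> \<le> \<epsilon>"
proof -
  have "uniformly_continuous_on {a..b} \<phi>"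
    using \<phi> by (intro compact_uniformly_continuous) auto
  then obtain \<delta> where \<delta>: "0 < \<delta>"
    "\<And>s t. s \<in> {a..b} \<Longrightarrow> t \<in> {a..b} \<Longrightarrow> \<bar>t - s\<bar> < \<delta> \<Longrightarrow> \<bar>\<phi> t - \<phi> s\<bar> < \<epsilon>"
    using \<epsilon> unfolding uniformly_continuous_on_def dist_real_def by blast
  obtain m :: nat where m: "(b - a) / \<delta> < real m"
    using reals_Archimedean2 by blast
  have m0: "0 < real m"
    using m \<delta>(1) ab by (meson diff_gt_0_iff_gt divide_pos_pos order.strict_trans)
  define h where "h = (b - a) / m"
  have h: "0 < h" "h < \<delta>" "h * m = b - a"
    using m m0 \<delta>(1) ab by (auto simp: h_def field_simps)
  \<comment> \<open>The equidistant grid runs on beyond \<open>b\<close>, which keeps it monotone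
    for every index; the oscillation bound concerns only \<open>j < m\<close>.\<close>
  define T where "T j = a + h * real j" for j
  show ?thesis
  proof
    show "T j \<le> T (Suc j)" "T 0 = a" "T m = b" for j
      using h by (auto simp: T_def algebra_simps)
    fix j t assume j: "j < m" and t: "t \<in> {T j<..T (Suc j)}"
    have "h * real (Suc j) \<le> h * real m" "0 \<le> h * real j"
      using j h(1) by (auto intro!: mult_left_mono)
    then have "a \<le> T j" "T (Suc j) \<le> b"
      using h(3) by (auto simp: T_def)
    moreover have "T (Suc j) - T j = h"
      by (simp add: T_def algebra_simps)
    ultimately show "\<bar>\<phi> t - \<phi> (T (Suc j))\<bar> \<le> \<epsilon>"
      using t h(2) by (intro less_imp_le \<delta>(2)) auto
  qed
qed

text \<open>Continuity from above along intervals that exhaust the line. The bound holds for all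
  larger radii, so that one radius can serve several measures.\<close>

lemma (in finite_borel_measure) measure_outside_small:
  assumes "0 < \<epsilon>"
  obtains R where "0 < R" "\<And>r. R \<le> r \<Longrightarrow> measure M (UNIV - {-r<..r}) \<le> \<epsilon>"
proof -
  have "(\<lambda>n. measure M (UNIV - {-real n<..real n})) \<longlonglongrightarrow> measure M (\<Inter>n. UNIV - {-real n<..real n})"
    by (rule finite_Lim_measure_decseq) (auto simp: decseq_def M_is_borel)
  also have "(\<Inter>n. UNIV - {-real n<..real n}) = {}"
    using UN_Ioc_eq_UNIV by auto
  finally have "\<forall>\<^sub>F n in sequentially. measure M (UNIV - {-real n<..real n}) < \<epsilon>"
    using assms by (auto dest!: order_tendstoD(2))
  then obtain n where n: "measure M (UNIV - {-real (Suc n)<..real (Suc n)}) < \<epsilon>"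
    unfolding eventually_sequentially by (meson le_Suc_eq order_refl)
  show ?thesis
  proof
    show "0 < real (Suc n)" by simp
    fix r assume "real (Suc n) \<le> r"
    then have "measure M (UNIV - {-r<..r}) \<le> measure M (UNIV - {-real (Suc n)<..real (Suc n)})"
      by (intro finite_measure_mono) (auto simp: M_is_borel)
    with n show "measure M (UNIV - {-r<..r}) \<le> \<epsilon>" by simp
  qed
qed

section \<open>Ramp functions and averages of distribution functions\<close>

text \<open>For positive \<delta> this is the normalised length of
  \<open>{y..y + \<delta>} \<inter> {t..}\<close>, that is, the probability that a uniform point of
  \<open>{y..y + \<delta>}\<close> lies at or above \<open>t\<close>.\<close>

definition ramp :: "real \<Rightarrow> real \<Rightarrow> real \<Rightarrow> real" where
  "ramp y \<delta> t = max 0 (y + \<delta> - max y t) / \<delta>"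

lemma continuous_on_ramp: "continuous_on UNIV (ramp y \<delta>)"
  unfolding ramp_def[abs_def] divide_inverse by (intro continuous_intros)

lemma ramp_bounds:
  assumes "0 < \<delta>" shows "0 \<le> ramp y \<delta> t" "ramp y \<delta> t \<le> 1"
  using assms by (auto simp: ramp_def field_simps)

lemma bounded_range_ramp: "0 < \<delta> \<Longrightarrow> bounded (range (ramp y \<delta>))"
  unfolding bounded_iff using ramp_bounds[of \<delta> y] by (intro exI[of _ 1]) auto

lemma prob_space_uniform_Icc:
  "0 < \<delta> \<Longrightarrow> prob_space (uniform_measure lborel {y..y + \<delta> :: real})"
  by (rule prob_space_uniform_measure) auto

lemma measure_uniform_atLeast:
  assumes "0 < \<delta>"
  shows "measure (uniform_measure lborel {y..y + \<delta>}) {t..} = ramp y \<delta> t"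
proof -
  have "{y..y + \<delta>} \<inter> {t..} = {max y t..y + \<delta>}" by auto
  then show ?thesis
    using assms by (subst measure_uniform_measure) (auto simp: ramp_def max_def)
qed

text \<open>Layer-cake: the ramp is the average of the indicators of \<open>{..z}\<close> over \<open>z \<in> {y..y + \<delta>}\<close>.\<close>

lemma (in finite_borel_measure) integral_ramp:
  assumes \<delta>: "0 < \<delta>"
  shows "(\<integral>t. ramp y \<delta> t \<partial>M) = (\<integral>z. cdf M z \<partial>uniform_measure lborel {y..y + \<delta>})"
proof -
  let ?N = "uniform_measure lborel {y..y + \<delta>} :: real measure"
  note M_is_borel[measurable_cong]
  interpret N: prob_space ?N by (rule prob_space_uniform_Icc[OF \<delta>])
  interpret MN: pair_sigma_finite M ?N ..
  interpret P: finite_measure "M \<Otimes>\<^sub>M ?N"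
    by (rule finite_measure_pair_measure) unfold_locales
  let ?f = "\<lambda>t z. if t \<le> z then 1 else 0 :: real"
  have "integrable (M \<Otimes>\<^sub>M ?N) (case_prod ?f)"
    by (rule P.integrable_const_bound[where B = 1]) auto
  then have "(\<integral>z. (\<integral>t. ?f t z \<partial>M) \<partial>?N) = (\<integral>t. (\<integral>z. ?f t z \<partial>?N) \<partial>M)"
    by (rule MN.Fubini_integral)
  moreover have "(\<integral>t. ?f t z \<partial>M) = cdf M z" for z
  proof -
    have "(\<integral>t. ?f t z \<partial>M) = (\<integral>t. indicator {..z} t \<partial>M)"
      by (intro Bochner_Integration.integral_cong) (auto simp: indicator_def)
    then show ?thesis by (simp add: cdf_def borel_UNIV)
  qed
  moreover have "(\<integral>z. ?f t z \<partial>?N) = ramp y \<delta> t" for t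
  proof -
    have "(\<integral>z. ?f t z \<partial>?N) = (\<integral>z. indicator {t..} z \<partial>?N)"
      by (intro Bochner_Integration.integral_cong) (auto simp: indicator_def)
    then show ?thesis by (simp add: measure_uniform_atLeast[OF \<delta>])
  qed
  ultimately show ?thesis by simp
qed

text \<open>Subtracting the layer-cake identities of the Jordan parts turns the integral into the
  mean of \<open>\<kappa> {..z}\<close> over the window, so an oscillation bound on the window
  bounds the error.\<close>

lemma signed_integral_ramp:
  assumes \<kappa>: "signed_measure \<kappa>" and \<delta>: "0 < \<delta>"
    and c: "\<And>z. z \<in> {y..y + \<delta>} \<Longrightarrow> \<bar>\<kappa> {..z} - \<kappa> {..y}\<bar> \<le> c"
  shows "\<bar>signed_integral \<kappa> (ramp y \<delta>) - \<kappa> {..y}\<bar> \<le> c"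
proof -
  let ?N = "uniform_measure lborel {y..y + \<delta>} :: real measure"
  interpret N: prob_space ?N by (rule prob_space_uniform_Icc[OF \<delta>])
  interpret P: finite_borel_measure "pos_part \<kappa>" by (rule finite_borel_measure_pos_part[OF \<kappa>])
  interpret Q: finite_borel_measure "neg_part \<kappa>" by (rule finite_borel_measure_neg_part[OF \<kappa>])
  have int: "integrable ?N (cdf M)" if "finite_borel_measure M" for M
  proof -
    interpret finite_borel_measure M by fact
    have "cdf M \<in> borel_measurable borel"
      by (rule borel_measurable_mono) (auto simp: mono_def cdf_nondecreasing)
    then show ?thesis
      by (intro N.integrable_const_bound[where B = "measure M (space M)"])
        (auto simp: cdf_nonneg cdf_bounded cong: measurable_cong_sets)
  qed
  have intP: "integrable ?N (cdf (pos_part \<kappa>))" and intQ: "integrable ?N (cdf (neg_part \<kappa>))"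
    by (intro int P.finite_borel_measure_axioms Q.finite_borel_measure_axioms)+
  have int\<kappa>: "integrable ?N (\<lambda>z. \<kappa> {..z})"
    unfolding signed_measure_atMost[OF \<kappa>] using intP intQ by simp
  have "signed_integral \<kappa> (ramp y \<delta>) = (\<integral>z. \<kappa> {..z} \<partial>?N)"
    unfolding signed_integral_def P.integral_ramp[OF \<delta>] Q.integral_ramp[OF \<delta>]
      signed_measure_atMost[OF \<kappa>] using intP intQ by simp
  then have "\<bar>signed_integral \<kappa> (ramp y \<delta>) - \<kappa> {..y}\<bar> = \<bar>\<integral>z. \<kappa> {..z} - \<kappa> {..y} \<partial>?N\<bar>"
    using int\<kappa> N.prob_space by simp
  also have "\<dots> \<le> (\<integral>z. \<bar>\<kappa> {..z} - \<kappa> {..y}\<bar> \<partial>?N)"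
    by (rule integral_abs_bound)
  \<comment> \<open>The bound \<open>c\<close> is available only on the window, which carries the
    full mass of the uniform measure; hence the almost-everywhere comparison.\<close>
  also have "\<dots> \<le> (\<integral>z. c \<partial>?N)"
    using int\<kappa> c by (intro integral_mono_AE AE_uniform_measureI) auto
  also have "\<dots> = c" using N.prob_space by simp
  finally show ?thesis .
qed

subsection \<open>Tight sequences\<close>

text \<open>Monotone functions have countably many discontinuities, and an open interval is
  uncountable. With \<open>F\<close> and \<open>G\<close> together, two Helly limits can be compared
  at a common point.\<close>

lemma dense_continuity_points:
  fixes F G :: "real \<Rightarrow> real"
  assumes "mono F" "mono G" "a < b"
  obtains x where "a < x" "x < b" "isCont F x" "isCont G x"
proof -
  have "countable ({x. \<not> isCont F x} \<union> {x. \<not> isCont G x})"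
    by (intro countable_Un mono_ctble_discont assms)
  then have "\<not> {a<..<b} \<subseteq> {x. \<not> isCont F x} \<union> {x. \<not> isCont G x}"
    using uncountable_open_interval[of a b] assms(3) countable_subset by blast
  then show ?thesis using that by auto
qed

text \<open>Helly selection supplies a bounded, right-continuous, nondecreasing limit. Tightness on
  the left forces its limit at minus infinity to be 0, and its limit at plus infinity exists by
  monotonicity, so it is the distribution function of a finite measure.\<close>

lemma tight_Helly_selection:
  fixes M :: "nat \<Rightarrow> real measure"
  assumes M: "\<And>n. finite_borel_measure (M n)"
    and C: "\<And>n. measure (M n) UNIV \<le> C"
    and tight: "\<And>\<epsilon>. 0 < \<epsilon> \<Longrightarrow> \<exists>R. \<forall>n. \<forall>y < -R. cdf (M n) y \<le> \<epsilon>"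
  obtains s :: "nat \<Rightarrow> nat" and N where "strict_mono s" "finite_borel_measure N"
    "\<And>y. isCont (cdf N) y \<Longrightarrow> (\<lambda>n. cdf (M (s n)) y) \<longlonglongrightarrow> cdf N y"
proof -
  have nonneg: "0 \<le> cdf (M n) y" for n y
    by (rule finite_borel_measure.cdf_nonneg[OF M])
  have "cdf (M n) y \<le> C" for n y
    using finite_borel_measure.cdf_bounded[OF M, of n y] finite_borel_measure.borel_UNIV[OF M, of n]
      C[of n] by simp
  then have bdd: "\<bar>cdf (M n) y\<bar> \<le> C" for n y
    using nonneg[of n y] by simp
  have mono: "mono (cdf (M n))" for n
    by (intro monoI finite_borel_measure.cdf_nondecreasing[OF M])
  obtain s F where s: "strict_mono (s :: nat \<Rightarrow> nat)"
    and F: "\<And>y. continuous (at_right y) F" "mono F" "\<And>y. \<bar>F y\<bar> \<le> C"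
    and lim: "\<And>y. isCont F y \<Longrightarrow> (\<lambda>n. cdf (M (s n)) y) \<longlonglongrightarrow> F y"
    using Helly_selection[where f = "\<lambda>n. cdf (M n)" and M = C,
        OF finite_borel_measure.cdf_is_right_cont[OF M] mono bdd] by blast
  have F_nonneg: "0 \<le> F y" for y
  proof -
    \<comment> \<open>Convergence is known only at continuity points of \<open>F\<close>;
      monotonicity carries the bound from such a point to \<open>y\<close>. The upper bound below
      uses a continuity point to the right of \<open>y\<close> in the same way.\<close>
    obtain z where z: "z < y" "isCont F z"
      using dense_continuity_points[OF F(2) F(2), of "y - 1" y] by auto
    have "0 \<le> F z"
      by (rule LIMSEQ_le_const[OF lim[OF z(2)]]) (use nonneg in auto)
    with z F(2) show ?thesis by (meson less_imp_le monoD order_trans)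
  qed
  have "(F \<longlongrightarrow> 0) at_bot"
  proof (rule tendstoI)
    fix \<epsilon> :: real assume "0 < \<epsilon>"
    then obtain R where R: "\<And>n y. y < -R \<Longrightarrow> cdf (M n) y \<le> \<epsilon> / 2"
      using tight[of "\<epsilon> / 2"] by auto
    have "\<bar>F y\<bar> < \<epsilon>" if y: "y < -R" for y
    proof -
      obtain z where z: "y < z" "z < -R" "isCont F z"
        using dense_continuity_points[OF F(2) F(2) y] by auto
      have "F z \<le> \<epsilon> / 2"
        by (rule LIMSEQ_le_const2[OF lim[OF z(3)]]) (use R z in auto)
      then have "F y \<le> \<epsilon> / 2"
        using z(1) F(2) by (meson less_imp_le monoD order_trans)
      then show ?thesis using F_nonneg[of y] \<open>0 < \<epsilon>\<close> by simp
    qed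
    then show "\<forall>\<^sub>F y in at_bot. dist (F y) 0 < \<epsilon>"
      unfolding eventually_at_bot_dense by (auto simp: dist_real_def)
  qed
  moreover have "\<exists>L. (F \<longlongrightarrow> L) at_top"
  proof -
    have "Bseq (\<lambda>n. F (real n))"
      using F(3) by (intro BseqI'[of _ C]) auto
    moreover have "monoseq (\<lambda>n. F (real n))"
      using F(2) by (auto simp: monoseq_def mono_def)
    ultimately have "convergent (\<lambda>n. F (real n))"
      by (rule Bseq_monoseq_convergent)
    then show ?thesis
      using F(2) by (auto simp: convergent_def mono_def intro!: tendsto_at_topI_sequentially_real)
  qed
  then obtain L where L: "(F \<longlongrightarrow> L) at_top" by blast
  moreover have "0 \<le> L"
    using L F_nonneg by (auto intro: tendsto_lowerbound)
  ultimately have "finite_borel_measure (interval_measure F)" "cdf (interval_measure F) = F"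
    using F(1,2) by (auto intro!: finite_borel_measure_interval_measure cdf_interval_measure simp: mono_def)
  then show ?thesis
    using that[OF s, of "interval_measure F"] lim by simp
qed

section \<open>Consequences of the interval estimate\<close>

text \<open>An argument of Arzela-Ascoli type. The errors \<open>s n\<close> vanish in the limit,
  which leaves \<omega> as a modulus for \<open>l\<close>. A finite net then upgrades pointwise
  convergence to uniform convergence on a compact set.\<close>

lemma equicontinuous_limit_continuous:
  fixes f :: "nat \<Rightarrow> real \<Rightarrow> real"
  assumes lim: "\<And>y. (\<lambda>n. f n y) \<longlonglongrightarrow> l y"
    and s: "s \<longlonglongrightarrow> 0" and \<omega>: "modulus_of_continuity \<omega>"
    and f: "\<And>n y z. 2 \<le> n \<Longrightarrow> y \<le> z \<Longrightarrow> \<bar>f n z - f n y\<bar> \<le> s n + \<omega> \<bar>y - z\<bar>"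
  shows "continuous_on UNIV l" "locally_uniform_limit f l"
proof -
  have f': "\<bar>f n y - f n z\<bar> \<le> s n + \<omega> \<bar>y - z\<bar>" if "2 \<le> n" for n y z
    using f[OF that, of y z] f[OF that, of z y] by (cases "y \<le> z") (auto simp: abs_minus_commute)
  have l: "\<bar>l y - l z\<bar> \<le> \<omega> \<bar>y - z\<bar>" for y z
  proof -
    have "(\<lambda>n. \<bar>f n y - f n z\<bar>) \<longlonglongrightarrow> \<bar>l y - l z\<bar>"
      by (intro tendsto_intros lim)
    moreover have "(\<lambda>n. s n + \<omega> \<bar>y - z\<bar>) \<longlonglongrightarrow> \<omega> \<bar>y - z\<bar>"
      using tendsto_add[OF s tendsto_const] by simp
    ultimately show ?thesis
      by (rule LIMSEQ_le) (use f' in blast)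
  qed
  have small: "\<exists>\<delta>>0. \<forall>y z. \<bar>y - z\<bar> < \<delta> \<longrightarrow> \<omega> \<bar>y - z\<bar> < \<epsilon>" if \<epsilon>: "0 < \<epsilon>" for \<epsilon>
  proof -
    have "\<forall>\<^sub>F r in at_right 0. \<omega> r < \<epsilon>"
      using \<omega> \<epsilon> unfolding modulus_of_continuity_def by (intro order_tendstoD(2)[of _ 0]) auto
    then obtain \<delta> where \<delta>: "0 < \<delta>" "\<And>r. 0 < r \<Longrightarrow> r < \<delta> \<Longrightarrow> \<omega> r < \<epsilon>"
      unfolding eventually_at_right[OF zero_less_one] by blast
    have "\<omega> \<bar>y - z\<bar> < \<epsilon>" if "\<bar>y - z\<bar> < \<delta>" for y z
      using \<delta>(2)[of "\<bar>y - z\<bar>"] that \<omega> \<epsilon> by (cases "y = z") (auto simp: modulus_of_continuity_def)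
    then show ?thesis using \<delta>(1) by blast
  qed
  show "continuous_on UNIV l"
    unfolding continuous_on_iff dist_real_def using small l by (meson UNIV_I le_less_trans)
  show "locally_uniform_limit f l"
    unfolding locally_uniform_limit_def uniform_limit_iff
  proof (intro allI impI)
    fix K :: "real set" and \<epsilon> :: real assume K: "compact K" and \<epsilon>: "0 < \<epsilon>"
    \<comment> \<open>The quarters are \<open>s n\<close> and \<omega> for moving \<open>f n\<close>
      from \<open>y\<close> to a net point \<open>t\<close>, the pointwise error at
      \<open>t\<close>, and \<omega> for moving \<open>l\<close> back to \<open>y\<close>.\<close>
    obtain \<delta> where \<delta>: "0 < \<delta>" "\<And>y z. \<bar>y - z\<bar> < \<delta> \<Longrightarrow> \<omega> \<bar>y - z\<bar> < \<epsilon> / 4"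
      using small[of "\<epsilon> / 4"] \<epsilon> by auto
    obtain D where D: "finite D" "K \<subseteq> (\<Union>t\<in>D. ball t \<delta>)"
      using K \<delta>(1) unfolding compact_eq_totally_bounded by meson
    have "\<forall>\<^sub>F n in sequentially. \<forall>t\<in>D. \<bar>f n t - l t\<bar> < \<epsilon> / 4"
      using D(1) tendstoD[OF lim, of "\<epsilon> / 4"] \<epsilon> by (simp add: eventually_ball_finite_distrib dist_real_def)
    moreover have "\<forall>\<^sub>F n in sequentially. s n < \<epsilon> / 4"
      using s \<epsilon> by (intro order_tendstoD(2)[of _ 0]) auto
    moreover have "\<forall>\<^sub>F n :: nat in sequentially. 2 \<le> n"
      by (rule eventually_ge_at_top)
    ultimately show "\<forall>\<^sub>F n in sequentially. \<forall>y\<in>K. dist (f n y) (l y) < \<epsilon>"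
    proof eventually_elim
      case (elim n)
      show ?case
      proof
        fix y assume "y \<in> K"
        then obtain t where t: "t \<in> D" "\<bar>y - t\<bar> < \<delta>"
          using D(2) by (auto simp: dist_real_def abs_minus_commute)
        then show "dist (f n y) (l y) < \<epsilon>"
          using bspec[OF elim(1) t(1)] elim(2) f'[OF elim(3), of y t] l[of y t] \<delta>(2)[OF t(2)]
          unfolding dist_real_def by linarith
      qed
    qed
  qed
qed

text \<open>The indicator of \<open>{..y}\<close> is not a continuous test function, so both sides
  are compared with the integral of a ramp. For the sequence the error is controlled by the interval
  estimate, for \<kappa> by right continuity of \<open>\<kappa> {..z}\<close> at
  \<open>y\<close>.\<close>

lemma narrow_limit_atMost:
  assumes \<kappa>s: "\<And>n. signed_measure (\<kappa>s n)" and \<kappa>: "signed_measure \<kappa>"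
    and narrow: "narrowly_converges \<kappa>s \<kappa>"
    and s: "s \<longlonglongrightarrow> 0" and \<omega>: "modulus_of_continuity \<omega>"
    and bound: "\<And>n y z. 2 \<le> n \<Longrightarrow> y \<le> z \<Longrightarrow> \<bar>\<kappa>s n {..z} - \<kappa>s n {..y}\<bar> \<le> s n + \<omega> \<bar>y - z\<bar>"
  shows "(\<lambda>n. \<kappa>s n {..y}) \<longlonglongrightarrow> \<kappa> {..y}"
proof (rule tendstoI)
  fix \<epsilon> :: real assume \<epsilon>: "0 < \<epsilon>"
  have "continuous (at_right y) (\<lambda>z. \<kappa> {..z})"
    unfolding signed_measure_atMost[OF \<kappa>]
    by (intro continuous_intros finite_borel_measure.cdf_is_right_cont
        finite_borel_measure_pos_part finite_borel_measure_neg_part \<kappa>)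
  then have "\<forall>\<^sub>F z in at_right y. \<bar>\<kappa> {..z} - \<kappa> {..y}\<bar> < \<epsilon> / 4"
    unfolding continuous_within dist_real_def[symmetric] by (rule tendstoD) (use \<epsilon> in simp)
  then obtain b where b: "y < b" "\<And>z. y < z \<Longrightarrow> z < b \<Longrightarrow> \<bar>\<kappa> {..z} - \<kappa> {..y}\<bar> < \<epsilon> / 4"
    unfolding eventually_at_right[OF less_add_one] by blast
  have "\<forall>\<^sub>F r in at_right 0. \<omega> r < \<epsilon> / 4"
    using \<omega> \<epsilon> unfolding modulus_of_continuity_def by (intro order_tendstoD(2)[of _ 0]) auto
  then obtain d where d: "0 < d" "\<And>r. 0 < r \<Longrightarrow> r < d \<Longrightarrow> \<omega> r < \<epsilon> / 4"
    unfolding eventually_at_right[OF zero_less_one] by blast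
  \<comment> \<open>Halving keeps the window strictly inside both neighbourhoods, as their bounds
    hold only on open intervals.\<close>
  define \<delta> where "\<delta> = min (b - y) d / 2"
  have \<delta>: "0 < \<delta>" "y + \<delta> < b" "\<delta> < d"
    using b(1) d(1) by (auto simp: \<delta>_def min_def field_simps)
  have ramp: "\<bar>signed_integral \<kappa> (ramp y \<delta>) - \<kappa> {..y}\<bar> \<le> \<epsilon> / 4"
  proof (rule signed_integral_ramp[OF \<kappa> \<delta>(1)])
    fix z assume "z \<in> {y..y + \<delta>}"
    then show "\<bar>\<kappa> {..z} - \<kappa> {..y}\<bar> \<le> \<epsilon> / 4"
      using b(2)[of z] \<delta>(2) \<epsilon> by (cases "z = y") auto
  qed
  have ramp_n: "\<bar>signed_integral (\<kappa>s n) (ramp y \<delta>) - \<kappa>s n {..y}\<bar> \<le> s n + \<omega> \<delta>" if n: "2 \<le> n" for n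
  proof (rule signed_integral_ramp[OF \<kappa>s \<delta>(1)])
    fix z assume z: "z \<in> {y..y + \<delta>}"
    \<comment> \<open>Monotonicity of \<omega> gives one oscillation bound for the whole
      window.\<close>
    have "mono_on {0..} \<omega>"
      using \<omega> by (simp add: modulus_of_continuity_def)
    then have "\<omega> \<bar>y - z\<bar> \<le> \<omega> \<delta>"
      by (rule mono_onD) (use z \<delta>(1) in auto)
    then show "\<bar>\<kappa>s n {..z} - \<kappa>s n {..y}\<bar> \<le> s n + \<omega> \<delta>"
      using bound[OF n, of y z] z by simp
  qed
  have "(\<lambda>n. signed_integral (\<kappa>s n) (ramp y \<delta>)) \<longlonglongrightarrow> signed_integral \<kappa> (ramp y \<delta>)"
    using narrow continuous_on_ramp bounded_range_ramp[OF \<delta>(1)]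
    unfolding narrowly_converges_def by blast
  then have "\<forall>\<^sub>F n in sequentially. \<bar>signed_integral (\<kappa>s n) (ramp y \<delta>) - signed_integral \<kappa> (ramp y \<delta>)\<bar> < \<epsilon> / 4"
    unfolding dist_real_def[symmetric] by (rule tendstoD) (use \<epsilon> in simp)
  moreover have "\<forall>\<^sub>F n in sequentially. s n < \<epsilon> / 4"
    using s \<epsilon> by (intro order_tendstoD(2)[of _ 0]) auto
  moreover have "\<forall>\<^sub>F n :: nat in sequentially. 2 \<le> n"
    by (rule eventually_ge_at_top)
  ultimately show "\<forall>\<^sub>F n in sequentially. dist (\<kappa>s n {..y}) (\<kappa> {..y}) < \<epsilon>"
  proof eventually_elim
    case (elim n)
    then show ?case
      using ramp ramp_n[of n] d(2)[OF \<delta>(1,3)] unfolding dist_real_def by linarith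
  qed
qed

text \<open>The left limit of \<open>\<kappa> {..z}\<close> at \<open>y\<close> is
  \<open>\<kappa> {..<y}\<close>, so the jump that continuity excludes is exactly
  \<open>\<kappa> {y}\<close>.\<close>

lemma no_atoms_if_continuous:
  assumes \<kappa>: "signed_measure \<kappa>" and cont: "continuous_on UNIV (\<lambda>y. \<kappa> {..y})"
  shows "no_atoms \<kappa>"
  unfolding no_atoms_def
proof
  fix y
  interpret P: finite_borel_measure "pos_part \<kappa>" by (rule finite_borel_measure_pos_part[OF \<kappa>])
  interpret Q: finite_borel_measure "neg_part \<kappa>" by (rule finite_borel_measure_neg_part[OF \<kappa>])
  have "((\<lambda>z. \<kappa> {..z}) \<longlongrightarrow> \<kappa> {..<y}) (at_left y)"
    unfolding signed_measure_atMost[OF \<kappa>]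
    by (subst signed_measure_eq_pos_minus_neg[OF \<kappa>]) (auto intro!: tendsto_diff P.cdf_at_left Q.cdf_at_left)
  moreover have "((\<lambda>z. \<kappa> {..z}) \<longlongrightarrow> \<kappa> {..y}) (at_left y)"
    using cont by (auto simp: continuous_on_def intro: tendsto_within_subset)
  ultimately have "\<kappa> {..<y} = \<kappa> {..y}"
    using tendsto_unique trivial_limit_at_left_real by blast
  moreover have "{..y} - {..<y} = {y}" by auto
  ultimately show "\<kappa> {y} = 0"
    using signed_measure_Diff[OF \<kappa>, of "{..y}" "{..<y}"] by fastforce
qed

section \<open>Bounded and tight sequences of signed measures\<close>

locale tight_signed_sequence =
  fixes \<kappa>s :: "nat \<Rightarrow> real set \<Rightarrow> real"
  assumes signed: "signed_measure (\<kappa>s n)"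
    and bounded: "bounded_variation_seq \<kappa>s"
    and tight: "tight_seq \<kappa>s"
begin

lemma mass_bound:
  obtains C where "0 \<le> C" "\<And>n. 2 \<le> n \<Longrightarrow> measure (pos_part (\<kappa>s n)) UNIV \<le> C"
    "\<And>n. 2 \<le> n \<Longrightarrow> measure (neg_part (\<kappa>s n)) UNIV \<le> C"
proof -
  obtain C where C: "0 \<le> C" "(SUP n \<in> {2..}. total_variation (\<kappa>s n) UNIV) = ennreal C"
    using bounded unfolding bounded_variation_seq_def
    by (cases "SUP n \<in> {2..}. total_variation (\<kappa>s n) UNIV") auto
  have TV: "total_variation (\<kappa>s n) UNIV \<le> ennreal C" if "2 \<le> n" for n
    using that C(2) by (metis SUP_upper atLeast_iff)
  show ?thesis
  proof
    fix n :: nat assume n: "2 \<le> n"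
    have "emeasure (pos_part (\<kappa>s n)) UNIV \<le> ennreal C"
      "emeasure (neg_part (\<kappa>s n)) UNIV \<le> ennreal C"
      using TV[OF n] pos_part_le_total_variation[OF signed, of UNIV n]
        neg_part_le_total_variation[OF signed, of UNIV n] by auto
    then show "measure (pos_part (\<kappa>s n)) UNIV \<le> C" "measure (neg_part (\<kappa>s n)) UNIV \<le> C"
      using C(1) by (auto simp: measure_def enn2real_leI)
  qed fact
qed

text \<open>Stated for every Borel set that misses \<open>{-R..R}\<close>, so that half-lines,
  bounded intervals in the tail and complements of half-open intervals can all be inserted.\<close>

lemma tails:
  assumes "0 < \<epsilon>"
  obtains R where "0 < R"
    "\<And>n A. 2 \<le> n \<Longrightarrow> A \<in> sets borel \<Longrightarrow> A \<inter> {-R..R} = {} \<Longrightarrow> measure (pos_part (\<kappa>s n)) A \<le> \<epsilon>"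
    "\<And>n A. 2 \<le> n \<Longrightarrow> A \<in> sets borel \<Longrightarrow> A \<inter> {-R..R} = {} \<Longrightarrow> measure (neg_part (\<kappa>s n)) A \<le> \<epsilon>"
    "\<And>n A. 2 \<le> n \<Longrightarrow> A \<in> sets borel \<Longrightarrow> A \<inter> {-R..R} = {} \<Longrightarrow> \<bar>\<kappa>s n A\<bar> \<le> \<epsilon>"
proof -
  obtain R where R: "0 < R" "\<And>n. 2 \<le> n \<Longrightarrow> total_variation (\<kappa>s n) (UNIV - {-R..R}) < ennreal \<epsilon>"
    using tight assms unfolding tight_seq_def by blast
  have *: "measure (pos_part (\<kappa>s n)) A \<le> \<epsilon> \<and> measure (neg_part (\<kappa>s n)) A \<le> \<epsilon>"
    if n: "2 \<le> n" and A: "A \<in> sets borel" "A \<inter> {-R..R} = {}" for n A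
  proof -
    have "emeasure M A \<le> ennreal \<epsilon>"
      if M: "sets M = sets borel"
        "emeasure M (UNIV - {-R..R}) \<le> total_variation (\<kappa>s n) (UNIV - {-R..R})" for M
    proof -
      have "emeasure M A \<le> emeasure M (UNIV - {-R..R})"
        by (rule emeasure_mono) (use A M in auto)
      then show ?thesis using M(2) R(2)[OF n] by order
    qed
    then show ?thesis
      using pos_part_le_total_variation[OF signed, of "UNIV - {-R..R}" n]
        neg_part_le_total_variation[OF signed, of "UNIV - {-R..R}" n] assms
      by (simp add: measure_def enn2real_leI)
  qed
  \<comment> \<open>A difference of two numbers between 0 and \<epsilon> is at most \<epsilon> in
    modulus.\<close>
  have **: "\<bar>\<kappa>s n A\<bar> \<le> \<epsilon>"
    if "2 \<le> n" "A \<in> sets borel" "A \<inter> {-R..R} = {}" for n A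
    using *[OF that] measure_nonneg[of "pos_part (\<kappa>s n)" A] measure_nonneg[of "neg_part (\<kappa>s n)" A]
    unfolding signed_measure_eq_pos_minus_neg[OF signed that(2), of n] by linarith
  show ?thesis
    by (rule that[OF R(1)]) (use * ** in simp_all)
qed

lemma atMost_diff:
  "y \<le> z \<Longrightarrow> \<kappa>s n {..z} - \<kappa>s n {..y} = \<kappa>s n {y<..z}"
  using signed_measure_Un[OF signed, of "{..y}" "{y<..z}" n] by (simp add: ivl_disj_un ivl_disj_int)

text \<open>Tail estimates that are uniform in \<open>n\<close> survive the pointwise limit as weak
  inequalities. On the left the values are compared with 0; on the right they are compared with
  those at \<open>R\<close>, since the total charge may be nonzero.\<close>

lemma limit_tails:
  assumes lim: "\<And>y. (\<lambda>n. \<kappa>s n {..y}) \<longlonglongrightarrow> u y" and \<epsilon>: "0 < \<epsilon>"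
  obtains R where "0 < R"
    "\<And>n y. 2 \<le> n \<Longrightarrow> y < -R \<Longrightarrow> \<bar>\<kappa>s n {..y}\<bar> \<le> \<epsilon>" "\<And>y. y < -R \<Longrightarrow> \<bar>u y\<bar> \<le> \<epsilon>"
    "\<And>n y. 2 \<le> n \<Longrightarrow> R < y \<Longrightarrow> \<bar>\<kappa>s n {..y} - \<kappa>s n {..R}\<bar> \<le> \<epsilon>"
    "\<And>y. R < y \<Longrightarrow> \<bar>u y - u R\<bar> \<le> \<epsilon>"
proof -
  obtain R where R: "0 < R"
    "\<And>n A. 2 \<le> n \<Longrightarrow> A \<in> sets borel \<Longrightarrow> A \<inter> {-R..R} = {} \<Longrightarrow> \<bar>\<kappa>s n A\<bar> \<le> \<epsilon>"
    using tails[OF \<epsilon>] by metis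
  have left: "\<bar>\<kappa>s n {..y}\<bar> \<le> \<epsilon>" if "2 \<le> n" "y < -R" for n y
    by (rule R(2)) (use that in auto)
  have right: "\<bar>\<kappa>s n {..y} - \<kappa>s n {..R}\<bar> \<le> \<epsilon>" if "2 \<le> n" "R < y" for n y
    unfolding atMost_diff[OF less_imp_le[OF that(2)]] by (rule R(2)) (use that in auto)
  have "\<bar>u y\<bar> \<le> \<epsilon>" if "y < -R" for y
    by (rule LIMSEQ_le_const2[OF tendsto_rabs[OF lim]]) (use left that in auto)
  moreover have "\<bar>u y - u R\<bar> \<le> \<epsilon>" if "R < y" for y
    by (rule LIMSEQ_le_const2[OF tendsto_rabs[OF tendsto_diff[OF lim lim]]]) (use right that in auto)
  ultimately show ?thesis
    using that R(1) left right by blast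
qed

lemma locally_uniform_limitD:
  assumes "locally_uniform_limit (\<lambda>n y. \<kappa>s n {..y}) u"
  shows "(\<lambda>n. \<kappa>s n {..y}) \<longlonglongrightarrow> u y"
proof -
  have "uniform_limit {y} (\<lambda>n y. \<kappa>s n {..y}) u sequentially"
    using assms compact_sing[of y] unfolding locally_uniform_limit_def by blast
  from tendsto_uniform_limitI[OF this, of y] show ?thesis by simp
qed

text \<open>On the left tail both functions are small. On the right tail both are nearly constant,
  so their distance there is governed by the one at \<open>R\<close>, which belongs to the compact
  interval.\<close>

lemma locally_uniform_imp_uniform:
  assumes loc: "locally_uniform_limit (\<lambda>n y. \<kappa>s n {..y}) u"
  shows "uniform_limit UNIV (\<lambda>n y. \<kappa>s n {..y}) u sequentially"
  unfolding uniform_limit_iff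
proof (intro allI impI)
  fix \<epsilon> :: real assume \<epsilon>: "0 < \<epsilon>"
  obtain R where R: "0 < R"
    "\<And>n y. 2 \<le> n \<Longrightarrow> y < -R \<Longrightarrow> \<bar>\<kappa>s n {..y}\<bar> \<le> \<epsilon> / 4" "\<And>y. y < -R \<Longrightarrow> \<bar>u y\<bar> \<le> \<epsilon> / 4"
    "\<And>n y. 2 \<le> n \<Longrightarrow> R < y \<Longrightarrow> \<bar>\<kappa>s n {..y} - \<kappa>s n {..R}\<bar> \<le> \<epsilon> / 4"
    "\<And>y. R < y \<Longrightarrow> \<bar>u y - u R\<bar> \<le> \<epsilon> / 4"
    using limit_tails[OF locally_uniform_limitD[OF loc], of "\<epsilon> / 4"] \<epsilon> by auto
  have "uniform_limit {-R..R} (\<lambda>n y. \<kappa>s n {..y}) u sequentially"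
    using loc unfolding locally_uniform_limit_def by auto
  then have "\<forall>\<^sub>F n in sequentially. \<forall>y\<in>{-R..R}. dist (\<kappa>s n {..y}) (u y) < \<epsilon> / 4"
    using \<epsilon> by (intro uniform_limitD) auto
  moreover have "\<forall>\<^sub>F n :: nat in sequentially. 2 \<le> n"
    by (rule eventually_ge_at_top)
  ultimately show "\<forall>\<^sub>F n in sequentially. \<forall>y\<in>UNIV. dist (\<kappa>s n {..y}) (u y) < \<epsilon>"
  proof eventually_elim
    case (elim n)
    show ?case
    proof
      fix y
      have R': "\<bar>\<kappa>s n {..R} - u R\<bar> < \<epsilon> / 4"
        using elim(1) R(1) by (auto simp: dist_real_def)
      consider "y < -R" | "y \<in> {-R..R}" | "R < y" by fastforce
      then show "dist (\<kappa>s n {..y}) (u y) < \<epsilon>"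
      proof cases
        case 1
        then show ?thesis using R(2)[OF elim(2) 1] R(3)[OF 1] \<epsilon> unfolding dist_real_def by linarith
      next
        case 2
        then show ?thesis using elim(1) \<epsilon> by fastforce
      next
        case 3
        then show ?thesis using R(4)[OF elim(2) 3] R(5)[OF 3] R' \<epsilon> unfolding dist_real_def by linarith
      qed
    qed
  qed
qed

lemma limit_uniformly_continuous:
  assumes lim: "\<And>y. (\<lambda>n. \<kappa>s n {..y}) \<longlonglongrightarrow> u y" and cont: "continuous_on UNIV u"
  shows "uniformly_continuous_on UNIV u"
  unfolding uniformly_continuous_on_def
proof (intro allI impI)
  fix \<epsilon> :: real assume \<epsilon>: "0 < \<epsilon>"
  obtain R where R: "0 < R" "\<And>y. y < -R \<Longrightarrow> \<bar>u y\<bar> \<le> \<epsilon> / 3" "\<And>y. R < y \<Longrightarrow> \<bar>u y - u R\<bar> \<le> \<epsilon> / 3"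
    using limit_tails[OF lim, of "\<epsilon> / 3"] \<epsilon> by (metis divide_pos_pos zero_less_numeral)
  \<comment> \<open>The margin of 1 ensures that two points at distance less than 1 lie both in this
    interval or both in the same tail.\<close>
  have "uniformly_continuous_on {-R-1..R+1} u"
    by (intro compact_uniformly_continuous continuous_on_subset[OF cont]) auto
  then obtain \<delta> where \<delta>: "0 < \<delta>"
    "\<And>y z. y \<in> {-R-1..R+1} \<Longrightarrow> z \<in> {-R-1..R+1} \<Longrightarrow> dist z y < \<delta> \<Longrightarrow> dist (u z) (u y) < \<epsilon>"
    using \<epsilon> unfolding uniformly_continuous_on_def by meson
  have "dist (u z) (u y) < \<epsilon>" if "dist z y < min \<delta> 1" for y z
  proof -
    consider "y \<in> {-R-1..R+1}" "z \<in> {-R-1..R+1}" | "y < -R" "z < -R" | "R < y" "R < z"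
      using \<open>dist z y < min \<delta> 1\<close> unfolding dist_real_def atLeastAtMost_iff by argo
    then show ?thesis
    proof cases
      case 1
      then show ?thesis using \<delta>(2) that by auto
    next
      case 2
      then show ?thesis using R(2)[of y] R(2)[of z] \<epsilon> unfolding dist_real_def by linarith
    next
      case 3
      then show ?thesis using R(3)[of y] R(3)[of z] \<epsilon> unfolding dist_real_def by linarith
    qed
  qed
  then show "\<exists>\<delta>>0. \<forall>y\<in>UNIV. \<forall>z\<in>UNIV. dist z y < \<delta> \<longrightarrow> dist (u z) (u y) < \<epsilon>"
    using \<delta>(1) by (intro exI[of _ "min \<delta> 1"]) auto
qed

section \<open>The limit measure, narrow convergence and the modulus\<close>

text \<open>Two successive Helly selections give limits \<open>N1\<close> and \<open>N2\<close> of
  the Jordan parts along a common subsequence, whose difference is the required measure. They may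
  overlap, so they need not be its Jordan parts.\<close>

lemma exists_limit_measure:
  assumes lim: "\<And>y. (\<lambda>n. \<kappa>s n {..y}) \<longlonglongrightarrow> u y" and cont: "continuous_on UNIV u"
  obtains \<kappa> where "signed_measure \<kappa>" "\<And>y. \<kappa> {..y} = u y"
proof -
  \<comment> \<open>The shift by 2 makes the bounds, which start at index 2, valid for all
    indices.\<close>
  let ?P = "\<lambda>n. pos_part (\<kappa>s (n + 2))" and ?Q = "\<lambda>n. neg_part (\<kappa>s (n + 2))"
  obtain C where C: "\<And>n. 2 \<le> n \<Longrightarrow> measure (pos_part (\<kappa>s n)) UNIV \<le> C"
    "\<And>n. 2 \<le> n \<Longrightarrow> measure (neg_part (\<kappa>s n)) UNIV \<le> C"
    using mass_bound by metis
  have tightP: "\<exists>R. \<forall>n. \<forall>y < -R. cdf (?P n) y \<le> \<epsilon>" and tightQ: "\<exists>R. \<forall>n. \<forall>y < -R. cdf (?Q n) y \<le> \<epsilon>"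
    if \<epsilon>: "0 < \<epsilon>" for \<epsilon>
  proof -
    obtain R where R: "0 < R"
      "\<And>n A. 2 \<le> n \<Longrightarrow> A \<in> sets borel \<Longrightarrow> A \<inter> {-R..R} = {} \<Longrightarrow> measure (pos_part (\<kappa>s n)) A \<le> \<epsilon>"
      "\<And>n A. 2 \<le> n \<Longrightarrow> A \<in> sets borel \<Longrightarrow> A \<inter> {-R..R} = {} \<Longrightarrow> measure (neg_part (\<kappa>s n)) A \<le> \<epsilon>"
      using tails[OF \<epsilon>] by metis
    have "cdf (?P n) y \<le> \<epsilon>" "cdf (?Q n) y \<le> \<epsilon>" if "y < -R" for n y
      unfolding cdf_def by (rule R; use that in auto)+
    then show "\<exists>R. \<forall>n. \<forall>y < -R. cdf (?P n) y \<le> \<epsilon>" "\<exists>R. \<forall>n. \<forall>y < -R. cdf (?Q n) y \<le> \<epsilon>"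
      by blast+
  qed
  obtain s N1 where s: "strict_mono s" and N1: "finite_borel_measure N1"
    and lim1: "\<And>y. isCont (cdf N1) y \<Longrightarrow> (\<lambda>n. cdf (?P (s n)) y) \<longlonglongrightarrow> cdf N1 y"
    using tight_Helly_selection[of ?P C] C(1) tightP finite_borel_measure_pos_part[OF signed]
    by (metis le_add2)
  obtain r N2 where r: "strict_mono r" and N2: "finite_borel_measure N2"
    and lim2: "\<And>y. isCont (cdf N2) y \<Longrightarrow> (\<lambda>n. cdf (?Q (s (r n))) y) \<longlonglongrightarrow> cdf N2 y"
  proof (rule tight_Helly_selection[of "\<lambda>n. ?Q (s n)" C])
    show "\<exists>R. \<forall>n. \<forall>y < -R. cdf (?Q (s n)) y \<le> \<epsilon>" if "0 < \<epsilon>" for \<epsilon>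
      using tightQ[OF that] by blast
  qed (use C(2) finite_borel_measure_neg_part[OF signed] in auto)
  interpret N1: finite_borel_measure N1 by fact
  interpret N2: finite_borel_measure N2 by fact
  let ?\<kappa> = "\<lambda>A. measure N1 A - measure N2 A"
  have eq: "u y = cdf N1 y - cdf N2 y" if y: "isCont (cdf N1) y" "isCont (cdf N2) y" for y
  proof -
    have "strict_mono (\<lambda>n. s (r n) + 2)"
      using s r by (simp add: strict_mono_def)
    then have "(\<lambda>n. \<kappa>s (s (r n) + 2) {..y}) \<longlonglongrightarrow> u y"
      using LIMSEQ_subseq_LIMSEQ[OF lim] by (simp add: comp_def)
    moreover have "(\<lambda>n. \<kappa>s (s (r n) + 2) {..y}) \<longlonglongrightarrow> cdf N1 y - cdf N2 y"
      unfolding signed_measure_atMost[OF signed]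
      using LIMSEQ_subseq_LIMSEQ[OF lim1[OF y(1)] r] lim2[OF y(2)]
      by (intro tendsto_diff) (auto simp: comp_def)
    ultimately show ?thesis
      by (rule LIMSEQ_unique)
  qed
  have "u y = cdf N1 y - cdf N2 y" for y
  proof (rule ccontr)
    \<comment> \<open>Right continuity would keep \<open>h\<close> nonzero on an interval to the
      right of \<open>y\<close>, but such an interval contains a common continuity point, where
      \<open>h\<close> vanishes by \<open>eq\<close>.\<close>
    define h where "h z = u z - (cdf N1 z - cdf N2 z)" for z
    assume "\<not> ?thesis"
    then have "h y \<noteq> 0" by (simp add: h_def)
    moreover have "continuous (at_right y) u"
      using cont by (simp add: continuous_on_eq_continuous_at continuous_at_imp_continuous_at_within)
    then have "continuous (at_right y) h"
      unfolding h_def[abs_def]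
      by (intro continuous_intros N1.cdf_is_right_cont N2.cdf_is_right_cont)
    ultimately have "\<forall>\<^sub>F z in at_right y. h z \<noteq> 0"
      unfolding continuous_within by (intro tendsto_imp_eventually_ne[where c = "h y"])
    then obtain b where b: "y < b" "\<And>z. y < z \<Longrightarrow> z < b \<Longrightarrow> h z \<noteq> 0"
      unfolding eventually_at_right[OF less_add_one] by blast
    obtain z where "y < z" "z < b" "isCont (cdf N1) z" "isCont (cdf N2) z"
      using dense_continuity_points[of "cdf N1" "cdf N2" y b] b(1)
        N1.cdf_nondecreasing N2.cdf_nondecreasing by (auto simp: mono_def)
    with b(2)[of z] eq[of z] show False by (simp add: h_def)
  qed
  then have "?\<kappa> {..y} = u y" for y
    by (simp add: cdf_def)
  with signed_measure_diff[OF N1 N2] show ?thesis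
    by (rule that)
qed

text \<open>The test function is replaced by a step function on a grid independent of
  \<open>n\<close>. The resulting sum \<open>S\<close> converges because it is a finite combination
  of the values \<open>\<kappa> {..T j}\<close>, and the replacement errors are uniform in
  \<open>n\<close>.\<close>

lemma narrowly_convergesI:
  assumes \<kappa>: "signed_measure \<kappa>" and lim: "\<And>y. (\<lambda>n. \<kappa>s n {..y}) \<longlonglongrightarrow> \<kappa> {..y}"
  shows "narrowly_converges \<kappa>s \<kappa>"
  unfolding narrowly_converges_def
proof (intro allI impI tendstoI)
  fix \<phi> :: "real \<Rightarrow> real" and \<epsilon> :: real
  assume \<phi>: "continuous_on UNIV \<phi>" and "bounded (range \<phi>)" and \<epsilon>: "0 < \<epsilon>"
  then obtain B where B: "0 < B" "\<And>t. \<bar>\<phi> t\<bar> \<le> B"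
    unfolding bounded_pos by auto
  have [measurable]: "\<phi> \<in> borel_measurable borel"
    using \<phi> by (rule borel_measurable_continuous_onI)
  obtain C where C: "0 \<le> C" "\<And>n. 2 \<le> n \<Longrightarrow> measure (pos_part (\<kappa>s n)) UNIV \<le> C"
    "\<And>n. 2 \<le> n \<Longrightarrow> measure (neg_part (\<kappa>s n)) UNIV \<le> C"
    using mass_bound by metis
  define C' where "C' = measure (pos_part \<kappa>) UNIV + measure (neg_part \<kappa>) UNIV"
  \<comment> \<open>\<open>D\<close> collects the coefficients of \<eta> in the two replacement
    errors: \<open>C' + 2 * B\<close> for the limit and \<open>2 * C + 2 * B\<close> for the
    sequence. Together they cost half of \<epsilon>.\<close>
  define D where "D = 2 * C + C' + 4 * B"
  have D: "0 < D"
    using C(1) B(1) by (simp add: D_def C'_def add_nonneg_pos)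
  define \<eta> where "\<eta> = \<epsilon> / (2 * D)"
  have \<eta>: "0 < \<eta>" "\<eta> * D = \<epsilon> / 2"
    using \<epsilon> D by (auto simp: \<eta>_def)
  obtain R where R: "0 < R"
    "\<And>n A. 2 \<le> n \<Longrightarrow> A \<in> sets borel \<Longrightarrow> A \<inter> {-R..R} = {} \<Longrightarrow> measure (pos_part (\<kappa>s n)) A \<le> \<eta>"
    "\<And>n A. 2 \<le> n \<Longrightarrow> A \<in> sets borel \<Longrightarrow> A \<inter> {-R..R} = {} \<Longrightarrow> measure (neg_part (\<kappa>s n)) A \<le> \<eta>"
    using tails[OF \<eta>(1)] by metis
  obtain R1 where R1: "0 < R1" "\<And>r. R1 \<le> r \<Longrightarrow> measure (pos_part \<kappa>) (UNIV - {-r<..r}) \<le> \<eta>"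
    using finite_borel_measure.measure_outside_small[OF finite_borel_measure_pos_part[OF \<kappa>] \<eta>(1)] by blast
  obtain R2 where R2: "0 < R2" "\<And>r. R2 \<le> r \<Longrightarrow> measure (neg_part \<kappa>) (UNIV - {-r<..r}) \<le> \<eta>"
    using finite_borel_measure.measure_outside_small[OF finite_borel_measure_neg_part[OF \<kappa>] \<eta>(1)] by blast
  \<comment> \<open>The radius strictly exceeds \<open>R\<close>: the complement of
    \<open>{-r<..r}\<close> contains the point \<open>-r\<close>, which must lie outside
    \<open>{-R..R}\<close>.\<close>
  define r where "r = R + R1 + R2"
  have r: "R < r" "R1 \<le> r" "R2 \<le> r" "-r < r"
    using R(1) R1(1) R2(1) by (auto simp: r_def)
  obtain T m where T: "\<And>j. T j \<le> T (Suc j)" "T 0 = -r" "T m = r"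
    "\<And>j t. j < m \<Longrightarrow> t \<in> {T j<..T (Suc j)} \<Longrightarrow> \<bar>\<phi> t - \<phi> (T (Suc j))\<bar> \<le> \<eta>"
    using continuous_uniform_grid[OF continuous_on_subset[OF \<phi>] r(4) \<eta>(1)] by blast
  define S where "S \<nu> = (\<Sum>j<m. \<phi> (T (Suc j)) * (\<nu> {..T (Suc j)} - \<nu> {..T j}))" for \<nu> :: "real set \<Rightarrow> real"
  have step: "\<bar>signed_integral \<nu> \<phi> - S \<nu>\<bar> \<le> \<eta> * c + B * (2 * \<eta>)"
    if "signed_measure \<nu>" "measure (pos_part \<nu>) UNIV + measure (neg_part \<nu>) UNIV \<le> c"
      "measure (pos_part \<nu>) (UNIV - {-r<..r}) \<le> \<eta>" "measure (neg_part \<nu>) (UNIV - {-r<..r}) \<le> \<eta>"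
    for \<nu> c
  proof -
    have "\<bar>signed_integral \<nu> \<phi> - S \<nu>\<bar> \<le> \<eta> * (measure (pos_part \<nu>) UNIV + measure (neg_part \<nu>) UNIV)
        + B * (measure (pos_part \<nu>) (UNIV - {T 0<..T m}) + measure (neg_part \<nu>) (UNIV - {T 0<..T m}))"
      unfolding S_def using that(1) B(2) T(1,4) \<eta>(1)
      by (intro signed_step_approximation) auto
    also have "\<dots> \<le> \<eta> * c + B * (2 * \<eta>)"
      using that B(1) \<eta>(1) by (intro add_mono mult_left_mono) (auto simp: T)
    finally show ?thesis .
  qed
  have step_\<kappa>: "\<bar>signed_integral \<kappa> \<phi> - S \<kappa>\<bar> \<le> \<eta> * C' + B * (2 * \<eta>)"
    by (rule step[OF \<kappa>]) (use R1 R2 r in \<open>auto simp: C'_def\<close>)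
  have step_n: "\<bar>signed_integral (\<kappa>s n) \<phi> - S (\<kappa>s n)\<bar> \<le> \<eta> * (2 * C) + B * (2 * \<eta>)" if n: "2 \<le> n" for n
  proof (rule step[OF signed])
    have "(UNIV - {-r<..r}) \<inter> {-R..R} = {}"
      using r(1) by auto
    then show "measure (pos_part (\<kappa>s n)) (UNIV - {-r<..r}) \<le> \<eta>"
      "measure (neg_part (\<kappa>s n)) (UNIV - {-r<..r}) \<le> \<eta>"
      using R(2,3)[OF n] by auto
  qed (use C(2,3)[OF n] in simp)
  have "(\<lambda>n. S (\<kappa>s n)) \<longlonglongrightarrow> S \<kappa>"
    unfolding S_def by (intro tendsto_intros lim)
  then have "\<forall>\<^sub>F n in sequentially. \<bar>S (\<kappa>s n) - S \<kappa>\<bar> < \<epsilon> / 2"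
    unfolding dist_real_def[symmetric] by (rule tendstoD) (use \<epsilon> in simp)
  moreover have "\<forall>\<^sub>F n :: nat in sequentially. 2 \<le> n"
    by (rule eventually_ge_at_top)
  ultimately show "\<forall>\<^sub>F n in sequentially. dist (signed_integral (\<kappa>s n) \<phi>) (signed_integral \<kappa> \<phi>) < \<epsilon>"
  proof eventually_elim
    case (elim n)
    have "(\<eta> * C' + B * (2 * \<eta>)) + (\<eta> * (2 * C) + B * (2 * \<eta>)) = \<epsilon> / 2"
      unfolding \<eta>(2)[symmetric] D_def by (simp add: algebra_simps)
    then show ?case
      using elim(1) step_\<kappa> step_n[OF elim(2)] unfolding dist_real_def by linarith
  qed
qed

text \<open>The error \<open>s n\<close> is twice the sup distance of the distribution functions,
  once for each endpoint, and \<omega> is the optimal modulus of \<open>u\<close>. Tightness makes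
  \<open>u\<close> uniformly continuous on the whole line, so this modulus tends to 0.\<close>

lemma modulus_estimate:
  assumes unif: "uniform_limit UNIV (\<lambda>n y. \<kappa>s n {..y}) u sequentially" and cont: "continuous_on UNIV u"
  shows "\<exists>s \<omega>. s \<longlonglongrightarrow> 0 \<and> modulus_of_continuity \<omega> \<and>
    (\<forall>n\<ge>2. \<forall>y z. y \<le> z \<longrightarrow> \<bar>\<kappa>s n {y<..z}\<bar> \<le> s n + \<omega> \<bar>y - z\<bar>)"
proof -
  have lim: "(\<lambda>n. \<kappa>s n {..y}) \<longlonglongrightarrow> u y" for y
    using tendsto_uniform_limitI[OF unif] by simp
  obtain C where C: "\<And>n. 2 \<le> n \<Longrightarrow> measure (pos_part (\<kappa>s n)) UNIV \<le> C"
    "\<And>n. 2 \<le> n \<Longrightarrow> measure (neg_part (\<kappa>s n)) UNIV \<le> C"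
    using mass_bound by metis
  have bound_n: "\<bar>\<kappa>s n {..y}\<bar> \<le> C" if n: "2 \<le> n" for n y
  proof -
    interpret P: finite_borel_measure "pos_part (\<kappa>s n)" by (rule finite_borel_measure_pos_part[OF signed])
    interpret Q: finite_borel_measure "neg_part (\<kappa>s n)" by (rule finite_borel_measure_neg_part[OF signed])
    show ?thesis
      using C[OF n] P.cdf_nonneg[of y] P.cdf_bounded[of y] Q.cdf_nonneg[of y] Q.cdf_bounded[of y]
      unfolding signed_measure_atMost[OF signed] P.borel_UNIV Q.borel_UNIV by linarith
  qed
  have bound: "\<bar>u y\<bar> \<le> C" for y
    by (rule LIMSEQ_le_const2[OF tendsto_rabs[OF lim]]) (use bound_n in auto)
  define e where "e n = (SUP y. \<bar>\<kappa>s n {..y} - u y\<bar>)" for n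
  have e: "\<bar>\<kappa>s n {..y} - u y\<bar> \<le> e n" if n: "2 \<le> n" for n y
  proof -
    have "\<bar>\<kappa>s n {..z} - u z\<bar> \<le> 2 * C" for z
      using bound_n[OF n, of z] bound[of z] by linarith
    then show ?thesis
      unfolding e_def by (intro cSUP_upper bdd_aboveI2) auto
  qed
  have e0: "e \<longlonglongrightarrow> 0"
  proof (rule tendstoI)
    fix \<epsilon> :: real assume \<epsilon>: "0 < \<epsilon>"
    have "\<forall>\<^sub>F n in sequentially. \<forall>y\<in>UNIV. dist (\<kappa>s n {..y}) (u y) < \<epsilon> / 2"
      using unif \<epsilon> by (intro uniform_limitD) auto
    moreover have "\<forall>\<^sub>F n :: nat in sequentially. 2 \<le> n"
      by (rule eventually_ge_at_top)
    ultimately show "\<forall>\<^sub>F n in sequentially. dist (e n) 0 < \<epsilon>"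
    proof eventually_elim
      case (elim n)
      have "e n \<le> \<epsilon> / 2"
        unfolding e_def using elim(1) by (intro cSUP_least) (auto simp: dist_real_def less_imp_le)
      moreover have "0 \<le> e n"
        using e[OF elim(2), of 0] by linarith
      ultimately show ?case using \<epsilon> by (simp add: dist_real_def)
    qed
  qed
  define \<omega> where "\<omega> r = (SUP p \<in> {(y, z). \<bar>y - z\<bar> \<le> r}. \<bar>u (fst p) - u (snd p)\<bar>)" for r
  have u_diff: "\<bar>u y - u z\<bar> \<le> 2 * C" for y z
    using bound[of y] bound[of z] by linarith
  have bdd: "bdd_above ((\<lambda>p. \<bar>u (fst p) - u (snd p)\<bar>) ` A)" for A
    by (rule bdd_aboveI2) (rule u_diff)
  have \<omega>: "\<bar>u y - u z\<bar> \<le> \<omega> r" if "\<bar>y - z\<bar> \<le> r" for y z r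
    unfolding \<omega>_def using cSUP_upper[OF _ bdd, of "(y, z)"] that by auto
  \<comment> \<open>For nonnegative \<open>r\<close> the index set contains the pair
    \<open>(0, 0)\<close>, so the supremum is over a nonempty set.\<close>
  have \<omega>_le: "\<omega> r \<le> c" if "0 \<le> r" "\<And>y z. \<bar>y - z\<bar> \<le> r \<Longrightarrow> \<bar>u y - u z\<bar> \<le> c" for r c
    unfolding \<omega>_def using that by (intro cSUP_least) (auto intro!: exI[of _ "0::real"])
  have \<omega>_nonneg: "0 \<le> \<omega> r" if "0 \<le> r" for r
    using \<omega>[of 0 0 r] that by simp
  have "modulus_of_continuity \<omega>"
    unfolding modulus_of_continuity_def
  proof (intro conjI allI impI)
    show "0 \<le> \<omega> r" if "0 \<le> r" for r
      by (rule \<omega>_nonneg[OF that])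
    show "mono_on {0..} \<omega>"
      by (intro mono_onI \<omega>_le) (auto intro: \<omega>)
    show "\<omega> 0 = 0"
      by (rule antisym[OF \<omega>_le \<omega>_nonneg]) auto
    show "(\<omega> \<longlongrightarrow> 0) (at_right 0)"
    proof (rule tendstoI)
      fix \<epsilon> :: real assume \<epsilon>: "0 < \<epsilon>"
      obtain \<delta> where \<delta>: "0 < \<delta>" "\<And>y z. \<bar>z - y\<bar> < \<delta> \<Longrightarrow> \<bar>u z - u y\<bar> < \<epsilon> / 2"
        using limit_uniformly_continuous[OF lim cont] \<epsilon>
        unfolding uniformly_continuous_on_def dist_real_def by (metis UNIV_I half_gt_zero)
      have "dist (\<omega> r) 0 < \<epsilon>" if r: "0 < r" "r < \<delta>" for r
      proof -
        have "\<omega> r \<le> \<epsilon> / 2"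
          using r \<delta>(2) by (intro \<omega>_le) (auto intro: less_imp_le)
        then show ?thesis using \<omega>_nonneg[of r] r \<epsilon> by (simp add: dist_real_def)
      qed
      then show "\<forall>\<^sub>F r in at_right 0. dist (\<omega> r) 0 < \<epsilon>"
        unfolding eventually_at_right[OF zero_less_one] using \<delta>(1) by blast
    qed
  qed
  moreover have "(\<lambda>n. 2 * e n) \<longlonglongrightarrow> 0"
    using tendsto_mult_right_zero[OF e0] .
  moreover have "\<bar>\<kappa>s n {y<..z}\<bar> \<le> 2 * e n + \<omega> \<bar>y - z\<bar>" if "2 \<le> n" "y \<le> z" for n y z
    using e[OF that(1), of y] e[OF that(1), of z] \<omega>[of y z "\<bar>y - z\<bar>"] atMost_diff[OF that(2), of n]
    by linarith
  ultimately show ?thesis by blast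
qed

end

section \<open>Empirical measures and the equivalence\<close>

lemma signed_measure_empirical: "signed_measure (empirical_measure x b n)"
  unfolding signed_measure_def
proof (intro conjI allI impI)
  fix A :: "nat \<Rightarrow> real set" assume "disjoint_family A"
  then have "(\<lambda>k. indicator (A k) t) sums (indicator (\<Union>k. A k) t :: real)" for t
    by (intro indicator_sums) (auto simp: disjoint_family_on_def)
  then show "(\<lambda>k. empirical_measure x b n (A k)) sums empirical_measure x b n (\<Union>k. A k)"
    unfolding empirical_measure_def by (intro sums_mult sums_sum)
qed (simp add: empirical_measure_def)

theorem lemma3:
  fixes x b :: "nat \<Rightarrow> nat \<Rightarrow> real"
    and \<kappa>\<^sub>n :: "nat \<Rightarrow> real set \<Rightarrow> real"
    and u\<^sub>n :: "nat \<Rightarrow> real \<Rightarrow> real"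
  assumes charges: "\<And>n i. n \<ge> 2 \<Longrightarrow> i \<in> {1..n} \<Longrightarrow> b n i \<in> {-1, 0, 1}"
    and \<kappa>\<^sub>n: "\<And>n. \<kappa>\<^sub>n n = empirical_measure x b n"
    and u\<^sub>n: "\<And>n y. u\<^sub>n n y = \<kappa>\<^sub>n n {..y}"
    and bounded: "bounded_variation_seq \<kappa>\<^sub>n"
    and tight: "tight_seq \<kappa>\<^sub>n"
  defines "C1 \<equiv> \<lambda>u. uniform_limit UNIV u\<^sub>n u sequentially \<and> continuous_on UNIV u"
    and "C2 \<equiv> \<lambda>u. locally_uniform_limit u\<^sub>n u \<and> continuous_on UNIV u"
    and "C3 \<equiv> \<lambda>\<kappa>. narrowly_converges \<kappa>\<^sub>n \<kappa> \<and> no_atoms \<kappa> \<and>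
      (\<exists>s \<omega>. s \<longlonglongrightarrow> 0 \<and> modulus_of_continuity \<omega> \<and>
        (\<forall>n\<ge>2. \<forall>y z. y \<le> z \<longrightarrow> \<bar>\<kappa>\<^sub>n n {y<..z}\<bar> \<le> s n + \<omega> \<bar>y - z\<bar>))"
  shows "(\<forall>u. C1 u \<longleftrightarrow> C2 u) \<and>
    (\<forall>u. C2 u \<longleftrightarrow> (\<exists>\<kappa>. signed_measure \<kappa> \<and> C3 \<kappa> \<and> (\<forall>y. u y = \<kappa> {..y}))) \<and>
    (\<forall>u \<kappa>. C2 u \<longrightarrow> signed_measure \<kappa> \<longrightarrow> C3 \<kappa> \<longrightarrow> (\<forall>y. u y = \<kappa> {..y}))"
proof -
  interpret tight_signed_sequence \<kappa>\<^sub>n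
    by unfold_locales (use bounded tight in \<open>simp_all add: \<kappa>\<^sub>n signed_measure_empirical\<close>)
  have u\<^sub>n_eq: "u\<^sub>n = (\<lambda>n y. \<kappa>\<^sub>n n {..y})"
    by (simp add: fun_eq_iff u\<^sub>n)
  have C12: "C1 u \<longleftrightarrow> C2 u" for u
    using locally_uniform_imp_uniform[of u] uniform_limit_on_subset[where J = UNIV and f = u\<^sub>n and g = u and F = sequentially]
    unfolding C1_def C2_def locally_uniform_limit_def u\<^sub>n_eq by blast
  have C32: "(\<lambda>n. \<kappa>\<^sub>n n {..y}) \<longlonglongrightarrow> \<kappa> {..y}" "C2 (\<lambda>y. \<kappa> {..y})"
    if \<kappa>: "signed_measure \<kappa>" "C3 \<kappa>" for \<kappa> y
  proof -
    obtain s \<omega> where s: "s \<longlonglongrightarrow> 0" and \<omega>: "modulus_of_continuity \<omega>"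
      and "\<And>n y z. 2 \<le> n \<Longrightarrow> y \<le> z \<Longrightarrow> \<bar>\<kappa>\<^sub>n n {y<..z}\<bar> \<le> s n + \<omega> \<bar>y - z\<bar>"
      using \<kappa>(2) unfolding C3_def by blast
    then have est: "\<bar>\<kappa>\<^sub>n n {..z} - \<kappa>\<^sub>n n {..y}\<bar> \<le> s n + \<omega> \<bar>y - z\<bar>" if "2 \<le> n" "y \<le> z" for n y z
      using that by (simp add: atMost_diff)
    have "narrowly_converges \<kappa>\<^sub>n \<kappa>"
      using \<kappa>(2) by (simp add: C3_def)
    then have lim: "(\<lambda>n. \<kappa>\<^sub>n n {..y}) \<longlonglongrightarrow> \<kappa> {..y}" for y
      using narrow_limit_atMost[OF signed \<kappa>(1) _ s \<omega> est] by blast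
    then show "(\<lambda>n. \<kappa>\<^sub>n n {..y}) \<longlonglongrightarrow> \<kappa> {..y}" .
    show "C2 (\<lambda>y. \<kappa> {..y})"
      unfolding C2_def u\<^sub>n_eq
      using equicontinuous_limit_continuous[where f = "\<lambda>n y. \<kappa>\<^sub>n n {..y}", OF lim s \<omega> est] by blast
  qed
  \<comment> \<open>The measure comes from compactness along a subsequence, but narrow convergence
    then holds for the full sequence, as its distribution functions converge at every point.\<close>
  have C23: "\<exists>\<kappa>. signed_measure \<kappa> \<and> C3 \<kappa> \<and> (\<forall>y. u y = \<kappa> {..y})" if u: "C2 u" for u
  proof -
    have cont: "continuous_on UNIV u" and loc: "locally_uniform_limit (\<lambda>n y. \<kappa>\<^sub>n n {..y}) u"
      using u by (auto simp: C2_def u\<^sub>n_eq)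
    note lim = locally_uniform_limitD[OF loc]
    obtain \<kappa> where \<kappa>: "signed_measure \<kappa>" "\<And>y. \<kappa> {..y} = u y"
      using exists_limit_measure[OF lim cont] by blast
    have "narrowly_converges \<kappa>\<^sub>n \<kappa>"
      by (rule narrowly_convergesI[OF \<kappa>(1)]) (simp add: \<kappa>(2) lim)
    moreover have "no_atoms \<kappa>"
      using no_atoms_if_continuous[OF \<kappa>(1)] cont by (simp add: \<kappa>(2))
    ultimately have "C3 \<kappa>"
      unfolding C3_def using modulus_estimate[OF locally_uniform_imp_uniform[OF loc] cont] by blast
    with \<kappa> show ?thesis by auto
  qed
  \<comment> \<open>Both values are the limit of the same real sequence, so limits obtained
    independently from \<open>C2\<close> and \<open>C3\<close> must match.\<close>
  have unique: "u y = \<kappa> {..y}" if "C2 u" "signed_measure \<kappa>" "C3 \<kappa>" for u \<kappa> y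
    using that C32(1)[OF that(2,3)] locally_uniform_limitD[of u y] LIMSEQ_unique
    unfolding C2_def u\<^sub>n_eq by blast
  have "C2 u" if "signed_measure \<kappa>" "C3 \<kappa>" "\<forall>y. u y = \<kappa> {..y}" for u \<kappa>
  proof -
    have "u = (\<lambda>y. \<kappa> {..y})" using that(3) by auto
    then show ?thesis using C32(2)[OF that(1,2)] by simp
  qed
  with C12 C23 unique show ?thesis by blast
qed

end
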